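(* Let $n=1$, $\Omega=\,]a,b[$ and $p>1$. Denote by $\lambda_1<\lambda_2<\lambda_3<\dots$ the eigenvalues of the Laplace operator $-\Delta$ in $H^1_0(]a,b[)$ and, for $k\in\mathbb{N}$ ($k\ge1$), let $e_k$ be an eigenfunction with eigenvalue $\lambda_k$. Assume that $w\in L^2(]a,b[)$ satisfies $$e_kw\ge0\ \text{ in }]a,b[,\qquad \inf_{]a,b[}|w|>\max\{\lambda_kt-t^p: t\ge0\}.$$ Set $h=k-1$ ($h$ is the number of zeroes of $e_k$ in $]a,b[$). Then every solution of the problem $$-u''=|u|^{p-1}u+w\ \text{ in }]a,b[,\qquad u(a)=u(b)=0$$ has in $]a,b[$ at least $h$ zeroes $\zeta_1,\zeta_2,\dots,\zeta_h$ such that $$\left|a+\frac{b-a}{k}\,i-\zeta_i\right|<\frac{b-a}{k}\qquad\text{for }i=1,\dots,h .$$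
   Context: Solutions are weak solutions in $H^1_0(]a,b[)$; inequalities and infima involving $w$ are understood in the almost-everywhere (essential) sense. *)

theory Defs
  imports "HOL-Analysis.Analysis" "HOL-Probability.Essential_Supremum"
begin

text \<open>
  Elements of \<open>L\<^sup>2\<close> and of the Sobolev spaces are represented by functions on the whole real
  line; only their restriction to the open set \<open>\<Omega>\<close>, up to Lebesgue-null sets, matters.
\<close>

definition L2_on :: "real set \<Rightarrow> (real \<Rightarrow> real) \<Rightarrow> bool" where
  "L2_on \<Omega> f \<longleftrightarrow>
     f \<in> borel_measurable (lebesgue_on \<Omega>) \<and> integrable (lebesgue_on \<Omega>) (\<lambda>x. (f x)\<^sup>2)"

definition test_function :: "real set \<Rightarrow> (real \<Rightarrow> real) \<Rightarrow> bool" where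
  "test_function \<Omega> \<phi> \<longleftrightarrow>
     (\<forall>n. (deriv ^^ n) \<phi> differentiable_on UNIV) \<and>
     compact (closure {x. \<phi> x \<noteq> 0}) \<and> closure {x. \<phi> x \<noteq> 0} \<subseteq> \<Omega>"

definition H1_deriv :: "real set \<Rightarrow> (real \<Rightarrow> real) \<Rightarrow> (real \<Rightarrow> real) \<Rightarrow> bool" where
  "H1_deriv \<Omega> u u' \<longleftrightarrow> L2_on \<Omega> u \<and> L2_on \<Omega> u' \<and>
     (\<forall>\<phi>. test_function \<Omega> \<phi> \<longrightarrow>
        (LINT x|lebesgue_on \<Omega>. u x * deriv \<phi> x) = - (LINT x|lebesgue_on \<Omega>. u' x * \<phi> x))"

text \<open>
  \<open>H10_deriv \<Omega> u u'\<close> says that \<open>u\<close> lies in the closure \<open>H\<^sup>1\<^sub>0(\<Omega>)\<close> of the test functions in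
  \<open>H\<^sup>1(\<Omega>)\<close> and that \<open>u'\<close> is (a representative of) its weak derivative.
\<close>

definition H10_deriv :: "real set \<Rightarrow> (real \<Rightarrow> real) \<Rightarrow> (real \<Rightarrow> real) \<Rightarrow> bool" where
  "H10_deriv \<Omega> u u' \<longleftrightarrow> H1_deriv \<Omega> u u' \<and>
     (\<exists>\<phi>. (\<forall>n. test_function \<Omega> (\<phi> n)) \<and>
        (\<lambda>n. LINT x|lebesgue_on \<Omega>. (\<phi> n x - u x)\<^sup>2) \<longlonglongrightarrow> 0 \<and>
        (\<lambda>n. LINT x|lebesgue_on \<Omega>. (deriv (\<phi> n) x - u' x)\<^sup>2) \<longlonglongrightarrow> 0)"

text \<open>
  Weak solutions in \<open>H\<^sup>1\<^sub>0(\<Omega>)\<close> of \<open>-u'' = f\<close>; for an equation whose right-hand side depends on the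
  unknown, \<open>f\<close> is that right-hand side evaluated at \<open>u\<close>. The integrability clause only excludes the
  default value of the Bochner integral; it holds automatically for \<open>f\<close> in \<open>L\<^sup>2(\<Omega>)\<close>.
\<close>

definition dirichlet_weak_solution :: "real set \<Rightarrow> (real \<Rightarrow> real) \<Rightarrow> (real \<Rightarrow> real) \<Rightarrow> bool" where
  "dirichlet_weak_solution \<Omega> f u \<longleftrightarrow>
     (\<exists>u'. H10_deriv \<Omega> u u' \<and>
        (\<forall>v v'. H10_deriv \<Omega> v v' \<longrightarrow>
           integrable (lebesgue_on \<Omega>) (\<lambda>x. f x * v x) \<and>
           (LINT x|lebesgue_on \<Omega>. u' x * v' x) = (LINT x|lebesgue_on \<Omega>. f x * v x)))"

definition dirichlet_eigenfunction :: "real set \<Rightarrow> real \<Rightarrow> (real \<Rightarrow> real) \<Rightarrow> bool" where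
  "dirichlet_eigenfunction \<Omega> \<mu> e \<longleftrightarrow>
     \<not> (AE x in lebesgue_on \<Omega>. e x = 0) \<and> dirichlet_weak_solution \<Omega> (\<lambda>x. \<mu> * e x) e"

definition dirichlet_eigenvalues :: "real set \<Rightarrow> real set" where
  "dirichlet_eigenvalues \<Omega> = {\<mu>. \<exists>e. dirichlet_eigenfunction \<Omega> \<mu> e}"

definition essinf :: "'a measure \<Rightarrow> ('a \<Rightarrow> real) \<Rightarrow> ereal" where
  "essinf M f = - esssup M (\<lambda>x. - ereal (f x))"

text \<open>Two continuous representatives of the same \<open>u\<close> coincide on the open set \<open>\<Omega>\<close>.\<close>

definition continuous_representative :: "real set \<Rightarrow> (real \<Rightarrow> real) \<Rightarrow> (real \<Rightarrow> real) \<Rightarrow> bool" where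
  "continuous_representative \<Omega> u v \<longleftrightarrow>
     continuous_on \<Omega> v \<and> (AE x in lebesgue_on \<Omega>. v x = u x)"

end

theory Submission
  imports Defs
begin

text \<open>
  On a nodal interval \<open>]c, d[\<close> of \<open>e\<^sub>k\<close> where \<open>w > 0\<close>, the solution \<open>u\<close> must be negative somewhere:
  otherwise testing the equation with the positive bump \<open>sin (\<omega> (x - c))\<close>, \<open>\<omega>\<^sup>2 = \<lambda>\<^sub>k\<close>, and integrating
  by parts (the boundary terms are \<open>- \<omega> (u c + u d) \<le> 0\<close>) contradicts \<open>u\<^sup>p + w > \<lambda>\<^sub>k u\<close>. Likewise \<open>u\<close> is
  positive somewhere where \<open>w < 0\<close>. As \<open>e\<^sub>k\<close> alternates, the intermediate value theorem gives a zero
  between the sign points of consecutive nodal intervals.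

  The eigenpairs are found by the same device: test functions glued from sine arcs with kinks at
  two points \<open>c, d\<close> turn the weak equation \<open>-e'' = \<omega>\<^sup>2 e\<close> into a linear relation between \<open>e c\<close> and \<open>e d\<close>.
\<close>

section \<open>Smooth functions and a smooth step\<close>

text \<open>The obstacle is that the sine bumps have kinks, whereas \<open>H10_deriv\<close> is a
  closure of smooth compactly supported functions. Their membership needs explicit approximations
  with bounded derivatives, and the smooth step and its derivative bound exist for that.

  No second derivative of \<open>u\<close> is ever formed. The integration by parts acts on the
  bump, and a kink leaves a point value of \<open>u\<close> behind; this is why a representative
  continuous up to the end points is constructed early.

  A bump on a nodal interval from \<open>c\<close> to \<open>d\<close> is not truncated at
  \<open>d\<close>: the sine wave started at \<open>d\<close> is added to the one started at
  \<open>c\<close>, and the two cancel beyond \<open>d\<close> because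
  \<open>\<omega> * (d - c) = pi\<close>. The only constraint on a combination with coefficients
  \<open>A, B\<close> is that it vanish at \<open>b\<close>.

  In the eigenvalue equation the integrals cancel, and what remains is
  \<open>A * U c + B * U d = 0\<close> whenever \<open>A * sin (\<omega> * (b - c)) + B * sin
  (\<omega> * (b - d)) = 0\<close>. Hence \<open>U\<close> is proportional to
  \<open>sin (\<omega> * (b - x))\<close>, which explains why phases are counted from the right end
  point throughout.\<close>

primrec differentiable_upto :: "nat \<Rightarrow> (real \<Rightarrow> real) \<Rightarrow> bool" where
  "differentiable_upto 0 f \<longleftrightarrow> (\<forall>x. f field_differentiable at x)"
| "differentiable_upto (Suc n) f \<longleftrightarrow>
     (\<forall>x. f field_differentiable at x) \<and> differentiable_upto n (deriv f)"

definition smooth :: "(real \<Rightarrow> real) \<Rightarrow> bool" where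
  "smooth f \<longleftrightarrow> (\<forall>n. differentiable_upto n f)"

text \<open>The recursion peels off the innermost derivative, so each closure property below is an
  induction on \<open>n\<close>: one exhibits the derivative by a formula built from functions to
  which the induction hypothesis applies.\<close>

lemma differentiable_upto_SucI:
  assumes "\<And>x. (f has_real_derivative f' x) (at x)" "differentiable_upto n f'"
  shows "differentiable_upto (Suc n) f"
proof -
  have "deriv f = f'" using assms(1) by (auto intro!: ext DERIV_imp_deriv)
  then show ?thesis using assms by (auto simp: field_differentiable_def)
qed

lemma differentiable_upto_imp_differentiable:
  "differentiable_upto n f \<Longrightarrow> f field_differentiable at x"
  by (cases n) auto

lemma differentiable_upto_imp_DERIV:
  "differentiable_upto n f \<Longrightarrow> (f has_real_derivative deriv f x) (at x)"
  using differentiable_upto_imp_differentiable DERIV_deriv_iff_field_differentiable by blast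

lemma differentiable_upto_mono: "differentiable_upto (Suc n) f \<Longrightarrow> differentiable_upto n f"
  by (induction n arbitrary: f) auto

lemma differentiable_upto_const: "differentiable_upto n (\<lambda>x. c)"
proof (induction n arbitrary: c)
  case 0
  then show ?case by simp
next
  case (Suc n)
  then show ?case by (intro differentiable_upto_SucI[where f'="\<lambda>x. 0"]) auto
qed

lemma differentiable_upto_add:
  "differentiable_upto n f \<Longrightarrow> differentiable_upto n g \<Longrightarrow> differentiable_upto n (\<lambda>x. f x + g x)"
proof (induction n arbitrary: f g)
  case 0
  then show ?case by (simp add: field_differentiable_add)
next
  case (Suc n)
  have "((\<lambda>x. f x + g x) has_real_derivative deriv f x + deriv g x) (at x)" for x
    using Suc.prems by (intro DERIV_add) (blast intro: differentiable_upto_imp_DERIV)+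
  then show ?case by (rule differentiable_upto_SucI) (use Suc in auto)
qed

lemma differentiable_upto_mult:
  "differentiable_upto n f \<Longrightarrow> differentiable_upto n g \<Longrightarrow> differentiable_upto n (\<lambda>x. f x * g x)"
proof (induction n arbitrary: f g)
  case 0
  then show ?case by (simp add: field_differentiable_mult)
next
  case (Suc n)
  then have "differentiable_upto n (\<lambda>x. deriv f x * g x + deriv g x * f x)"
    using differentiable_upto_mono by (intro differentiable_upto_add Suc.IH) auto
  moreover have "((\<lambda>x. f x * g x) has_real_derivative deriv f x * g x + deriv g x * f x) (at x)" for x
    using Suc.prems by (intro DERIV_mult) (blast intro: differentiable_upto_imp_DERIV)+
  ultimately show ?case by (intro differentiable_upto_SucI)
qed

lemma differentiable_upto_inverse:
  assumes "differentiable_upto n f" "\<And>x. f x \<noteq> 0"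
  shows "differentiable_upto n (\<lambda>x. inverse (f x))"
  using assms(1)
proof (induction n)
  case 0
  then show ?case using assms(2) by (simp add: field_differentiable_inverse)
next
  case (Suc n)
  \<comment> \<open>The derivative of the reciprocal is spelled with \<open>inverse (f x)\<close> as
    a factor, so the induction hypothesis for the same \<open>f\<close> covers it.\<close>
  then have "differentiable_upto n (\<lambda>x. - 1 * (inverse (f x) * deriv f x * inverse (f x)))"
    using differentiable_upto_mono
    by (intro differentiable_upto_mult differentiable_upto_const Suc.IH) auto
  moreover have "((\<lambda>x. inverse (f x)) has_real_derivative
      - 1 * (inverse (f x) * deriv f x * inverse (f x))) (at x)" for x
    using differentiable_upto_imp_DERIV[OF Suc.prems] DERIV_inverse' assms(2) by fastforce
  ultimately show ?case by (intro differentiable_upto_SucI) auto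
qed

lemma differentiable_upto_affine:
  "differentiable_upto n f \<Longrightarrow> differentiable_upto n (\<lambda>x. f (c * x + d))"
proof (induction n arbitrary: f)
  case 0
  have "((\<lambda>x. f (c * x + d)) has_real_derivative deriv f (c * x + d) * c) (at x)" for x
    by (rule DERIV_chain2[OF differentiable_upto_imp_DERIV[OF 0]])
       (auto intro!: derivative_eq_intros)
  then show ?case by (auto simp: field_differentiable_def)
next
  case (Suc n)
  have "((\<lambda>x. f (c * x + d)) has_real_derivative deriv f (c * x + d) * c) (at x)" for x
    by (rule DERIV_chain2[OF differentiable_upto_imp_DERIV[OF Suc.prems]])
       (auto intro!: derivative_eq_intros)
  moreover have "differentiable_upto n (\<lambda>x. deriv f (c * x + d) * c)"
    using Suc by (intro differentiable_upto_mult differentiable_upto_const Suc.IH) auto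
  ultimately show ?case by (intro differentiable_upto_SucI) auto
qed

text \<open>Proved jointly because each function is, up to sign, the derivative of the
  other.\<close>

lemma differentiable_upto_sin_cos: "differentiable_upto n sin \<and> differentiable_upto n cos"
proof (induction n)
  case 0
  then show ?case by (auto simp: field_differentiable_def intro: DERIV_sin DERIV_cos)
next
  case (Suc n)
  have "differentiable_upto n (\<lambda>x. -1 * sin x)"
    using Suc by (intro differentiable_upto_mult differentiable_upto_const) auto
  then have "differentiable_upto n (\<lambda>x. - sin x)" by simp
  with Suc show ?case
    by (auto intro!: differentiable_upto_SucI[of sin cos] differentiable_upto_SucI[of cos "\<lambda>x. - sin x"]
        DERIV_sin DERIV_cos simp del: differentiable_upto.simps)
qed

lemma smooth_const: "smooth (\<lambda>x. c)"
  by (simp add: smooth_def differentiable_upto_const)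

lemma smooth_add: "smooth f \<Longrightarrow> smooth g \<Longrightarrow> smooth (\<lambda>x. f x + g x)"
  by (simp add: smooth_def differentiable_upto_add)

lemma smooth_mult: "smooth f \<Longrightarrow> smooth g \<Longrightarrow> smooth (\<lambda>x. f x * g x)"
  by (simp add: smooth_def differentiable_upto_mult)

lemma smooth_inverse: "smooth f \<Longrightarrow> (\<And>x. f x \<noteq> 0) \<Longrightarrow> smooth (\<lambda>x. inverse (f x))"
  by (simp add: smooth_def differentiable_upto_inverse)

lemma smooth_affine:
  assumes "smooth f"
  shows "smooth (\<lambda>x. f (c * x + d))"
  unfolding smooth_def
proof
  show "differentiable_upto n (\<lambda>x. f (c * x + d))" for n
    using assms unfolding smooth_def by (intro differentiable_upto_affine) (rule spec)
qed

lemma smooth_sin: "smooth sin"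
  by (simp add: smooth_def differentiable_upto_sin_cos)

lemma smooth_cos: "smooth cos"
  by (simp add: smooth_def differentiable_upto_sin_cos)

lemma smooth_imp_DERIV: "smooth f \<Longrightarrow> (f has_real_derivative deriv f x) (at x)"
  using differentiable_upto_imp_DERIV smooth_def by blast

lemma smooth_deriv: "smooth f \<Longrightarrow> smooth (deriv f)"
  unfolding smooth_def using differentiable_upto.simps(2) by blast

lemma smooth_imp_continuous_on: "smooth f \<Longrightarrow> continuous_on A f"
  by (meson DERIV_continuous_on has_field_derivative_at_within smooth_imp_DERIV)

text \<open>Bridge to the iterated-derivative form in \<open>test_function\<close>. The two forms
  differ in where the extra \<open>deriv\<close> is attached, which \<open>funpow_Suc_right\<close>
  reconciles.\<close>

lemma smooth_iff: "smooth f \<longleftrightarrow> (\<forall>n. (deriv ^^ n) f differentiable_on UNIV)"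
proof
  assume f: "smooth f"
  have "smooth ((deriv ^^ n) f)" for n by (induction n) (auto simp: f smooth_deriv)
  then show "\<forall>n. (deriv ^^ n) f differentiable_on UNIV"
    by (meson differentiable_on_def field_differentiable_imp_differentiable
        differentiable_upto_imp_differentiable smooth_def differentiable_at_withinI)
next
  assume f: "\<forall>n. (deriv ^^ n) f differentiable_on UNIV"
  have "differentiable_upto n g" if "\<forall>n. (deriv ^^ n) g differentiable_on UNIV" for n g
    using that
  proof (induction n arbitrary: g)
    case 0
    have "g differentiable (at x)" for x using 0[rule_format, of 0] by (simp add: differentiable_on_def)
    then show ?case by (simp add: real_differentiable_def field_differentiable_def)
  next
    case (Suc n)
    have "g differentiable (at x)" for x
      using Suc.prems[rule_format, of 0] by (simp add: differentiable_on_def)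
    moreover have "(deriv ^^ n) (deriv g) differentiable_on UNIV" for n
      using Suc.prems[rule_format, of "Suc n"] by (simp only: funpow_Suc_right o_apply)
    ultimately show ?case using Suc.IH by (simp add: real_differentiable_def field_differentiable_def)
  qed
  then show "smooth f" using f by (auto simp: smooth_def)
qed

section \<open>A smooth transition built from exp (-1/x)\<close>

lemma tendsto_poly_times_exp_minus: "((\<lambda>y. poly P y * exp (- y)) \<longlongrightarrow> 0) at_top" for P :: "real poly"
proof -
  have "((\<lambda>y. \<Sum>i\<le>degree P. coeff P i * (y ^ i / exp y)) \<longlongrightarrow> (\<Sum>i\<le>degree P. coeff P i * 0)) at_top"
    by (intro tendsto_sum tendsto_mult tendsto_const tendsto_power_div_exp_0)
  moreover have "poly P y * exp (- y) = (\<Sum>i\<le>degree P. coeff P i * (y ^ i / exp y))" for y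
    by (simp add: poly_altdef sum_distrib_right exp_minus divide_inverse mult.assoc)
  ultimately show ?thesis by simp
qed

text \<open>The polynomial parameter makes the family closed under differentiation: with y = 1/x one
  has dy/dx = - y^2, so P(y) exp(-y) has derivative y^2 (P - P')(y) exp(-y). Smoothness then follows
  by induction over all \<open>P\<close> at once.\<close>

definition flat_exp :: "real poly \<Rightarrow> real \<Rightarrow> real" where
  "flat_exp P x = (if x > 0 then poly P (1 / x) * exp (- (1 / x)) else 0)"

lemma DERIV_flat_exp:
  "(flat_exp P has_real_derivative flat_exp ([:0, 0, 1:] * (P - pderiv P)) x) (at x)"
proof -
  consider "x > 0" | "x < 0" | "x = 0" by linarith
  then show ?thesis
  proof cases
    case 1
    have d: "((\<lambda>x. poly P (1 / x) * exp (- (1 / x))) has_real_derivative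
        flat_exp ([:0, 0, 1:] * (P - pderiv P)) x) (at x)"
    proof -
      have inv: "((\<lambda>x. 1 / x) has_real_derivative - (1 / x\<^sup>2)) (at x)"
        using 1 by (auto intro!: derivative_eq_intros simp: power2_eq_square)
      have "((\<lambda>x. poly P (1 / x)) has_real_derivative poly (pderiv P) (1 / x) * - (1 / x\<^sup>2)) (at x)"
        by (rule DERIV_chain2[OF poly_DERIV inv])
      moreover have "((\<lambda>x. exp (- (1 / x))) has_real_derivative exp (- (1 / x)) * - (- (1 / x\<^sup>2))) (at x)"
        by (rule DERIV_chain2[OF DERIV_exp DERIV_minus[OF inv]])
      ultimately have "((\<lambda>x. poly P (1 / x) * exp (- (1 / x))) has_real_derivative
          poly (pderiv P) (1 / x) * - (1 / x\<^sup>2) * exp (- (1 / x))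
          + exp (- (1 / x)) * - (- (1 / x\<^sup>2)) * poly P (1 / x)) (at x)"
        by (rule DERIV_mult)
      then show ?thesis
        using 1 by (simp add: flat_exp_def algebra_simps power2_eq_square)
    qed
    have ev: "\<forall>\<^sub>F y in nhds x. poly P (1 / y) * exp (- (1 / y)) = flat_exp P y"
      by (rule eventually_mono[OF eventually_nhds_in_open[of "{0<..}" x]])
         (use 1 in \<open>auto simp: flat_exp_def\<close>)
    show ?thesis by (rule DERIV_cong_ev[OF refl ev refl, THEN iffD1, OF d])
  next
    case 2
    have d: "((\<lambda>x. 0) has_real_derivative flat_exp ([:0, 0, 1:] * (P - pderiv P)) x) (at x)"
      using 2 by (auto simp: flat_exp_def)
    have ev: "\<forall>\<^sub>F y in nhds x. 0 = flat_exp P y"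
      by (rule eventually_mono[OF eventually_nhds_in_open[of "{..<0}" x]])
         (use 2 in \<open>auto simp: flat_exp_def\<close>)
    show ?thesis by (rule DERIV_cong_ev[OF refl ev refl, THEN iffD1, OF d])
  next
    case 3
    \<comment> \<open>The difference quotient at 0 carries an extra factor 1/x. In the variable 1/x
      this is one more power, hence the polynomial \<open>pCons 0 P\<close>.\<close>
    have "((\<lambda>y. poly (pCons 0 P) (inverse y) * exp (- inverse y)) \<longlongrightarrow> 0) (at_right 0)"
      by (rule filterlim_compose[OF tendsto_poly_times_exp_minus filterlim_inverse_at_top_right])
    moreover have "\<forall>\<^sub>F y in at_right 0.
        poly (pCons 0 P) (inverse y) * exp (- inverse y) = flat_exp P y / y"
      by (rule eventually_at_rightI[of 0 1]) (auto simp: flat_exp_def divide_inverse)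
    ultimately have "((\<lambda>y. flat_exp P y / y) \<longlongrightarrow> 0) (at_right 0)"
      by (rule Lim_transform_eventually)
    moreover have "((\<lambda>y. flat_exp P y / y) \<longlongrightarrow> 0) (at_left 0)"
    proof (rule Lim_transform_eventually[OF tendsto_const])
      show "\<forall>\<^sub>F y in at_left 0. 0 = flat_exp P y / y"
        by (rule eventually_at_leftI[of "-1"]) (auto simp: flat_exp_def)
    qed
    ultimately have "((\<lambda>y. flat_exp P y / y) \<longlongrightarrow> 0) (at 0)"
      using filterlim_at_split by blast
    then show ?thesis using 3 by (simp add: DERIV_def flat_exp_def)
  qed
qed

lemma smooth_flat_exp: "smooth (flat_exp P)"
proof -
  have "differentiable_upto n (flat_exp P)" for n
  proof (induction n arbitrary: P)
    case 0
    then show ?case unfolding differentiable_upto.simps field_differentiable_def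
      using DERIV_flat_exp by blast
  next
    case (Suc n)
    then show ?case using DERIV_flat_exp by (intro differentiable_upto_SucI) auto
  qed
  then show ?thesis by (simp add: smooth_def)
qed

text \<open>The classical quotient: the denominator is positive because x and 1 - x are never both
  nonpositive. The spellings \<open>- 1 * x + 1\<close> and \<open>inverse\<close> match
  \<open>smooth_affine\<close> and \<open>smooth_inverse\<close>.\<close>

definition smooth_step :: "real \<Rightarrow> real" where
  "smooth_step x = flat_exp 1 x * inverse (flat_exp 1 x + flat_exp 1 (- 1 * x + 1))"

lemma flat_exp_1_nonneg: "flat_exp 1 x \<ge> 0" by (simp add: flat_exp_def)

lemma smooth_step_denom: "flat_exp 1 x + flat_exp 1 (- 1 * x + 1) > 0"
proof (cases "x > 0")
  case True
  then have "flat_exp 1 x > 0" by (simp add: flat_exp_def)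
  then show ?thesis using flat_exp_1_nonneg[of "- 1 * x + 1"] by linarith
next
  case False
  then have "flat_exp 1 (- 1 * x + 1) > 0" by (simp add: flat_exp_def)
  then show ?thesis using flat_exp_1_nonneg[of x] by linarith
qed

lemma smooth_smooth_step: "smooth smooth_step"
proof -
  have "smooth (\<lambda>x. flat_exp 1 x + flat_exp 1 (- 1 * x + 1))"
    by (rule smooth_add[OF smooth_flat_exp smooth_affine[OF smooth_flat_exp]])
  from smooth_inverse[OF this] smooth_step_denom
  have "smooth (\<lambda>x. inverse (flat_exp 1 x + flat_exp 1 (- 1 * x + 1)))"
    by (metis less_irrefl)
  then have "smooth (\<lambda>x. flat_exp 1 x * inverse (flat_exp 1 x + flat_exp 1 (- 1 * x + 1)))"
    by (rule smooth_mult[OF smooth_flat_exp])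
  then show ?thesis by (simp add: smooth_step_def[abs_def])
qed

lemma smooth_step_eq_0: "x \<le> 0 \<Longrightarrow> smooth_step x = 0"
  by (simp add: smooth_step_def flat_exp_def)

lemma smooth_step_eq_1: "x \<ge> 1 \<Longrightarrow> smooth_step x = 1"
  by (simp add: smooth_step_def flat_exp_def)

lemma smooth_step_bounds: "0 \<le> smooth_step x" "smooth_step x \<le> 1"
  using smooth_step_denom[of x] flat_exp_1_nonneg[of x] flat_exp_1_nonneg[of "- 1 * x + 1"]
  by (auto simp: smooth_step_def field_simps)

lemma deriv_smooth_step_eq_0:
  assumes "x < 0 \<or> x > 1"
  shows "deriv smooth_step x = 0"
proof -
  have "\<exists>c. \<forall>\<^sub>F y in nhds x. c = smooth_step y"
    using assms
  proof
    assume "x < 0"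
    then show ?thesis
      by (intro exI[of _ 0] eventually_mono[OF eventually_nhds_in_open[of "{..<0}" x]])
         (auto simp: smooth_step_eq_0)
  next
    assume "x > 1"
    then show ?thesis
      by (intro exI[of _ 1] eventually_mono[OF eventually_nhds_in_open[of "{1<..}" x]])
         (auto simp: smooth_step_eq_1)
  qed
  then obtain c where "\<forall>\<^sub>F y in nhds x. c = smooth_step y" by blast
  then have "(smooth_step has_real_derivative 0) (at x)"
    using DERIV_cong_ev[of x x "\<lambda>_. c" smooth_step 0 0] by simp
  then show ?thesis by (rule DERIV_imp_deriv)
qed

lemma smooth_bounded_on_Icc:
  assumes "smooth f"
  obtains M where "M > 0" "\<And>x. x \<in> {a..b} \<Longrightarrow> \<bar>f x\<bar> \<le> M"
proof -
  have "compact (f ` {a..b})"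
    using assms by (intro compact_continuous_image smooth_imp_continuous_on) auto
  then have "bounded (f ` {a..b})" by (rule compact_imp_bounded)
  then obtain M where "M > 0" "\<forall>y\<in>f ` {a..b}. norm y \<le> M" using bounded_pos by metis
  then show ?thesis using that[of M] by simp
qed

text \<open>The derivative is continuous on \<open>{0..1}\<close> and zero elsewhere. A bound on the
  whole line is needed because the step is later rescaled by arbitrarily large factors.\<close>

lemma deriv_smooth_step_bounded:
  obtains M where "M > 0" "\<And>x. \<bar>deriv smooth_step x\<bar> \<le> M"
proof -
  obtain M where M: "M > 0" "\<And>x. x \<in> {0..1} \<Longrightarrow> \<bar>deriv smooth_step x\<bar> \<le> M"
    using smooth_bounded_on_Icc[OF smooth_deriv[OF smooth_smooth_step]] by metis
  have "\<bar>deriv smooth_step x\<bar> \<le> M" for x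
    using M deriv_smooth_step_eq_0[of x] by (cases "x \<in> {0..1}") (auto simp: not_le)
  with M(1) show ?thesis using that by blast
qed

section \<open>The Sobolev space of an interval\<close>

lemma finite_measure_lebesgue_on_Ioo: "finite_measure (lebesgue_on {a<..<b::real})"
  by (rule finite_measure_lebesgue_on) auto

lemma continuous_on_imp_measurable_Ioo:
  "continuous_on {a<..<b::real} f \<Longrightarrow> f \<in> borel_measurable (lebesgue_on {a<..<b})"
  by (rule continuous_imp_measurable_on_sets_lebesgue) auto

lemma continuous_on_Icc_imp_measurable_Ioo:
  assumes "continuous_on {a..b::real} f"
  shows "f \<in> borel_measurable (lebesgue_on {a<..<b})"
  by (intro continuous_on_imp_measurable_Ioo continuous_on_subset[OF assms]) auto

lemma smooth_measurable: "smooth f \<Longrightarrow> f \<in> borel_measurable (lebesgue_on {a<..<b})"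
  by (intro continuous_on_imp_measurable_Ioo smooth_imp_continuous_on)

lemma integrable_bounded_Ioo:
  fixes f :: "real \<Rightarrow> real"
  assumes "f \<in> borel_measurable (lebesgue_on {a<..<b})" "AE x in lebesgue_on {a<..<b}. \<bar>f x\<bar> \<le> C"
  shows "integrable (lebesgue_on {a<..<b}) f"
  by (rule finite_measure.integrable_const_bound[OF finite_measure_lebesgue_on_Ioo _ assms(1), of C])
     (use assms(2) in simp)

lemma L2_on_bounded_Ioo:
  assumes "f \<in> borel_measurable (lebesgue_on {a<..<b})" "AE x in lebesgue_on {a<..<b}. \<bar>f x\<bar> \<le> C"
  shows "L2_on {a<..<b} f"
  unfolding L2_on_def
proof
  show "integrable (lebesgue_on {a<..<b}) (\<lambda>x. (f x)\<^sup>2)"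
  proof (rule integrable_bounded_Ioo[where C="C\<^sup>2"])
    show "AE x in lebesgue_on {a<..<b}. \<bar>(f x)\<^sup>2\<bar> \<le> C\<^sup>2"
      using assms(2)
    proof eventually_elim
      case (elim x)
      then show ?case using power_mono[of "\<bar>f x\<bar>" C 2] by simp
    qed
  qed (use assms(1) in measurable)
qed (rule assms(1))

lemma L2_on_mult_integrable:
  assumes "L2_on \<Omega> f" "L2_on \<Omega> g"
  shows "integrable (lebesgue_on \<Omega>) (\<lambda>x. f x * g x)"
proof (rule Bochner_Integration.integrable_bound)
  show "integrable (lebesgue_on \<Omega>) (\<lambda>x. (f x)\<^sup>2 + (g x)\<^sup>2)"
    using assms by (auto simp: L2_on_def)
  show "(\<lambda>x. f x * g x) \<in> borel_measurable (lebesgue_on \<Omega>)"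
    using assms by (auto simp: L2_on_def)
  have "\<bar>y * z\<bar> \<le> y\<^sup>2 + z\<^sup>2" for y z :: real
  proof -
    have "2 * \<bar>y * z\<bar> \<le> y\<^sup>2 + z\<^sup>2"
      using sum_squares_bound[of "\<bar>y\<bar>" "\<bar>z\<bar>"] by (simp add: abs_mult)
    then show ?thesis using abs_ge_zero[of "y * z"] by linarith
  qed
  then show "AE x in lebesgue_on \<Omega>. norm (f x * g x) \<le> norm ((f x)\<^sup>2 + (g x)\<^sup>2)"
    by (auto intro!: AE_I2)
qed

lemma L2_on_linear:
  assumes "L2_on \<Omega> f" "L2_on \<Omega> g"
  shows "L2_on \<Omega> (\<lambda>x. f x + c * g x)"
proof -
  have "integrable (lebesgue_on \<Omega>) (\<lambda>x. (f x)\<^sup>2 + (2 * c) * (f x * g x) + c\<^sup>2 * (g x)\<^sup>2)"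
    using assms L2_on_mult_integrable[OF assms] by (auto simp: L2_on_def)
  moreover have "(f x)\<^sup>2 + (2 * c) * (f x * g x) + c\<^sup>2 * (g x)\<^sup>2 = (f x + c * g x)\<^sup>2" for x
    by (simp add: power2_eq_square algebra_simps)
  ultimately show ?thesis using assms by (auto simp: L2_on_def)
qed

lemma L2_on_diff: "L2_on \<Omega> f \<Longrightarrow> L2_on \<Omega> g \<Longrightarrow> L2_on \<Omega> (\<lambda>x. f x - g x)"
  using L2_on_linear[of \<Omega> f g "-1"] by simp

lemma L2_on_imp_integrable_Ioo:
  assumes "L2_on {a<..<b} f"
  shows "integrable (lebesgue_on {a<..<b}) f"
proof (rule finite_measure.square_integrable_imp_integrable[OF finite_measure_lebesgue_on_Ioo])
  show "f \<in> borel_measurable (lebesgue_on {a<..<b})"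
    "integrable (lebesgue_on {a<..<b}) (\<lambda>x. (f x)\<^sup>2)"
    using assms by (simp_all add: L2_on_def)
qed

text \<open>Cauchy-Schwarz in the form that a variance is nonnegative: integrate the square of the
  deviation of \<open>\<bar>f\<bar>\<close> from its mean \<open>c\<close>.\<close>

lemma L1_le_L2_Ioo:
  assumes "a < b" "L2_on {a<..<b} f"
  shows "(LINT x|lebesgue_on {a<..<b}. \<bar>f x\<bar>)\<^sup>2 \<le> (b - a) * (LINT x|lebesgue_on {a<..<b}. (f x)\<^sup>2)"
proof -
  let ?M = "lebesgue_on {a<..<b}"
  interpret finite_measure ?M by (rule finite_measure_lebesgue_on_Ioo)
  define c where "c = (LINT x|?M. \<bar>f x\<bar>) / (b - a)"
  have i: "integrable ?M (\<lambda>x. (f x)\<^sup>2)" "integrable ?M (\<lambda>x. \<bar>f x\<bar>)"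
    using assms(2) L2_on_imp_integrable_Ioo[OF assms(2)] by (simp_all add: L2_on_def)
  have m: "measure ?M {a<..<b} = b - a"
    using assms by (simp add: measure_restrict_space)
  have "0 \<le> (LINT x|?M. (f x)\<^sup>2 - (2 * c) * \<bar>f x\<bar> + c\<^sup>2)"
  proof (rule integral_nonneg_AE, rule AE_I2)
    fix x
    have "(f x)\<^sup>2 - (2 * c) * \<bar>f x\<bar> + c\<^sup>2 = (\<bar>f x\<bar> - c)\<^sup>2" by (simp add: power2_diff)
    then show "0 \<le> (f x)\<^sup>2 - (2 * c) * \<bar>f x\<bar> + c\<^sup>2" by simp
  qed
  also have "\<dots> = (LINT x|?M. (f x)\<^sup>2) - (2 * c) * (LINT x|?M. \<bar>f x\<bar>) + c\<^sup>2 * (b - a)"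
    using i m by (simp add: mult.commute)
  also have "\<dots> = (LINT x|?M. (f x)\<^sup>2) - (LINT x|?M. \<bar>f x\<bar>)\<^sup>2 / (b - a)"
  proof -
    have "(LINT x|?M. \<bar>f x\<bar>) = c * (b - a)" using assms(1) by (simp add: c_def)
    then show ?thesis using assms(1) by (simp add: power2_eq_square)
  qed
  finally show ?thesis using assms(1) by (simp add: field_simps)
qed

lemma L2_tendsto_imp_L1_tendsto_Ioo:
  assumes "a < b" "\<And>n. L2_on {a<..<b} (f n)"
    and lim: "(\<lambda>n. LINT x|lebesgue_on {a<..<b}. (f n x)\<^sup>2) \<longlonglongrightarrow> 0"
  shows "(\<lambda>n. LINT x|lebesgue_on {a<..<b}. \<bar>f n x\<bar>) \<longlonglongrightarrow> 0"
proof (rule tendsto_sandwich[OF _ _ tendsto_const])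
  let ?M = "lebesgue_on {a<..<b}"
  show "\<forall>\<^sub>F n in sequentially. 0 \<le> (LINT x|?M. \<bar>f n x\<bar>)"
    by (intro always_eventually allI integral_nonneg_AE) auto
  show "\<forall>\<^sub>F n in sequentially. (LINT x|?M. \<bar>f n x\<bar>) \<le> sqrt ((b - a) * (LINT x|?M. (f n x)\<^sup>2))"
    using L1_le_L2_Ioo[OF assms(1,2)] by (intro always_eventually allI real_le_rsqrt)
  show "(\<lambda>n. sqrt ((b - a) * (LINT x|?M. (f n x)\<^sup>2))) \<longlonglongrightarrow> 0"
    using tendsto_real_sqrt[OF tendsto_mult[OF tendsto_const[of "b - a"] lim]] by simp
qed

section \<open>Test functions and integration by parts\<close>

lemma test_function_smooth: "test_function \<Omega> \<phi> \<Longrightarrow> smooth \<phi>"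
  by (simp add: test_function_def smooth_iff)

lemma test_function_eq_0:
  assumes "test_function \<Omega> \<phi>" "x \<notin> \<Omega>"
  shows "\<phi> x = 0"
proof (rule ccontr)
  assume "\<phi> x \<noteq> 0"
  then have "x \<in> closure {x. \<phi> x \<noteq> 0}" by (intro closure_subset[THEN subsetD]) simp
  then show False using assms by (auto simp: test_function_def)
qed

lemma smooth_bounded_AE_Ioo:
  assumes "smooth f"
  obtains C where "AE x in lebesgue_on {a<..<b}. \<bar>f x\<bar> \<le> C"
proof -
  obtain C where "\<And>x. x \<in> {a..b} \<Longrightarrow> \<bar>f x\<bar> \<le> C" using smooth_bounded_on_Icc[OF assms] by metis
  then have "AE x in lebesgue_on {a<..<b}. \<bar>f x\<bar> \<le> C" by (auto intro!: AE_I2)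
  then show ?thesis using that by blast
qed

lemma L2_on_smooth:
  assumes "smooth f"
  shows "L2_on {a<..<b} f"
proof -
  obtain C where "AE x in lebesgue_on {a<..<b}. \<bar>f x\<bar> \<le> C" by (rule smooth_bounded_AE_Ioo[OF assms])
  then show ?thesis by (rule L2_on_bounded_Ioo[OF smooth_measurable[OF assms]])
qed

text \<open>Integration from \<open>c\<close> to \<open>b\<close> is expressed throughout by such a
  truncated integrand, so that every integral lives on the one measure space of the weak
  formulation.\<close>

lemma measurable_restrict_ge:
  fixes f :: "real \<Rightarrow> real"
  assumes "f \<in> borel_measurable (lebesgue_on {a<..<b})"
  shows "(\<lambda>x. if c \<le> x then f x else 0) \<in> borel_measurable (lebesgue_on {a<..<b})"
proof -
  have "(\<lambda>x::real. x) \<in> borel_measurable (lebesgue_on {a<..<b})"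
    by (intro continuous_on_imp_measurable_Ioo continuous_on_id)
  then show ?thesis using assms by measurable
qed

lemma integrable_restrict_ge:
  fixes f :: "real \<Rightarrow> real"
  assumes "integrable (lebesgue_on {a<..<b}) f"
  shows "integrable (lebesgue_on {a<..<b}) (\<lambda>x. if c \<le> x then f x else 0)"
  by (rule Bochner_Integration.integrable_bound[OF assms])
     (use measurable_restrict_ge[OF borel_measurable_integrable[OF assms]] in simp_all)

text \<open>The fundamental theorem is available for the gauge integral; integrability of the
  truncated derivative lets the value be transferred to the Lebesgue integral.\<close>

lemma integral_deriv_Ioo:
  assumes "smooth f" "c \<in> {a..b}"
  shows "(LINT x|lebesgue_on {a<..<b}. (if c \<le> x then deriv f x else 0)) = f b - f c"
proof -
  let ?g = "\<lambda>x. if c \<le> x then deriv f x else 0"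
  have "(deriv f has_integral f b - f c) {c..b}"
    using assms
    by (intro fundamental_theorem_of_calculus)
       (auto simp flip: has_real_derivative_iff_has_vector_derivative
         intro: has_field_derivative_at_within[OF smooth_imp_DERIV])
  then have "((\<lambda>x. if x \<in> {c..b} then deriv f x else 0) has_integral f b - f c) {a..b}"
    using assms(2) by (subst has_integral_restrict) auto
  then have "(?g has_integral f b - f c) {a..b}"
    by (rule has_integral_eq[rotated]) auto
  then have *: "(?g has_integral f b - f c) {a<..<b}"
    by (simp add: has_integral_Icc_iff_Ioo)
  have "integrable (lebesgue_on {a<..<b}) ?g"
    by (intro integrable_restrict_ge L2_on_imp_integrable_Ioo L2_on_smooth smooth_deriv assms)
  then have "integral\<^sup>L (lebesgue_on {a<..<b}) ?g = integral {a<..<b} ?g"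
    by (intro lebesgue_integral_eq_integral) auto
  then show ?thesis using * by (simp add: integral_unique)
qed

lemma integral_by_parts_Ioo:
  assumes "smooth f" "smooth g" "c \<in> {a..b}"
  shows "(LINT x|lebesgue_on {a<..<b}. (if c \<le> x then deriv f x * g x else 0))
    = f b * g b - f c * g c - (LINT x|lebesgue_on {a<..<b}. (if c \<le> x then f x * deriv g x else 0))"
proof -
  let ?M = "lebesgue_on {a<..<b}"
  have "deriv (\<lambda>x. f x * g x) x = deriv f x * g x + f x * deriv g x" for x
    using DERIV_mult[OF smooth_imp_DERIV[OF assms(1)] smooth_imp_DERIV[OF assms(2)], THEN DERIV_imp_deriv]
    by (simp add: mult.commute)
  then have "f b * g b - f c * g c =
      (LINT x|?M. (if c \<le> x then deriv f x * g x else 0) + (if c \<le> x then f x * deriv g x else 0))"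
    by (subst integral_deriv_Ioo[OF smooth_mult[OF assms(1,2)] assms(3), symmetric])
       (auto intro!: Bochner_Integration.integral_cong)
  also have "\<dots> = (LINT x|?M. (if c \<le> x then deriv f x * g x else 0))
      + (LINT x|?M. (if c \<le> x then f x * deriv g x else 0))"
    by (intro Bochner_Integration.integral_add integrable_restrict_ge L2_on_imp_integrable_Ioo
        L2_on_smooth smooth_mult smooth_deriv assms)
  finally show ?thesis by simp
qed

lemma test_function_by_parts:
  assumes "a < b" "test_function {a<..<b} \<phi>" "test_function {a<..<b} \<psi>"
  shows "(LINT x|lebesgue_on {a<..<b}. deriv \<phi> x * \<psi> x) = - (LINT x|lebesgue_on {a<..<b}. \<phi> x * deriv \<psi> x)"
proof -
  let ?M = "lebesgue_on {a<..<b}"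
  have *: "(LINT x|?M. (if a \<le> x then f x else 0)) = (LINT x|?M. f x)" for f :: "real \<Rightarrow> real"
    by (rule Bochner_Integration.integral_cong) auto
  have "(LINT x|?M. (if a \<le> x then deriv \<phi> x * \<psi> x else 0))
      = - (LINT x|?M. (if a \<le> x then \<phi> x * deriv \<psi> x else 0))"
    using integral_by_parts_Ioo[OF test_function_smooth[OF assms(2)] test_function_smooth[OF assms(3)], of a a b]
      test_function_eq_0[OF assms(2), of a] test_function_eq_0[OF assms(2), of b] assms(1) by simp
  then show ?thesis unfolding * .
qed

text \<open>On a bounded interval uniform bounds and pointwise convergence suffice: dominated
  convergence gives both L2 limits, and it also carries the integration by parts against a test
  function over to the limit.\<close>

lemma H10_derivI_dominated:
  assumes "a < b"
    and test: "\<And>n. test_function {a<..<b} (\<phi> n)"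
    and bound: "\<And>n x. x \<in> {a<..<b} \<Longrightarrow> \<bar>\<phi> n x\<bar> \<le> C"
      "\<And>n x. x \<in> {a<..<b} \<Longrightarrow> \<bar>deriv (\<phi> n) x\<bar> \<le> C"
    and lim: "AE x in lebesgue_on {a<..<b}. (\<lambda>n. \<phi> n x) \<longlonglongrightarrow> v x"
      "AE x in lebesgue_on {a<..<b}. (\<lambda>n. deriv (\<phi> n) x) \<longlonglongrightarrow> v' x"
    and meas: "v \<in> borel_measurable (lebesgue_on {a<..<b})" "v' \<in> borel_measurable (lebesgue_on {a<..<b})"
  shows "H10_deriv {a<..<b} v v'"
proof -
  let ?M = "lebesgue_on {a<..<b}"
  \<comment> \<open>Stated for a general sequence because it is used twice, for the functions and
    for their derivatives.\<close>
  have *: "L2_on {a<..<b} g \<and> (\<lambda>n. LINT x|?M. (f n x - g x)\<^sup>2) \<longlonglongrightarrow> 0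
      \<and> (smooth \<psi> \<longrightarrow> (\<lambda>n. LINT x|?M. f n x * \<psi> x) \<longlonglongrightarrow> (LINT x|?M. g x * \<psi> x))"
    if fC: "\<And>n x. x \<in> {a<..<b} \<Longrightarrow> \<bar>f n x\<bar> \<le> C" and fg: "AE x in ?M. (\<lambda>n. f n x) \<longlonglongrightarrow> g x"
      and m[measurable]: "g \<in> borel_measurable ?M" "\<And>n. f n \<in> borel_measurable ?M" for f g \<psi>
  proof (intro conjI impI)
    have gC: "AE x in ?M. \<bar>g x\<bar> \<le> C"
      using fg AE_space
    proof eventually_elim
      case (elim x)
      have "(\<lambda>n. \<bar>f n x\<bar>) \<longlonglongrightarrow> \<bar>g x\<bar>" using elim(1) by (rule tendsto_rabs)
      then show ?case by (rule LIMSEQ_le_const2) (use fC elim in auto)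
    qed
    then show "L2_on {a<..<b} g" by (rule L2_on_bounded_Ioo[rotated]) measurable
    have "(\<lambda>n. LINT x|?M. (f n x - g x)\<^sup>2) \<longlonglongrightarrow> (LINT x|?M. 0)"
    proof (rule integral_dominated_convergence[where w="\<lambda>x. (2 * C)\<^sup>2"])
      show "integrable ?M (\<lambda>x. (2 * C)\<^sup>2)" by (rule integrable_bounded_Ioo[where C="(2 * C)\<^sup>2"]) auto
      show "AE x in ?M. (\<lambda>n. (f n x - g x)\<^sup>2) \<longlonglongrightarrow> 0"
        using fg by eventually_elim
          (metis LIM_zero power_zero_numeral tendsto_power)
      show "AE x in ?M. norm ((f n x - g x)\<^sup>2) \<le> (2 * C)\<^sup>2" for n
        using gC AE_space
      proof eventually_elim
        case (elim x)
        have "\<bar>f n x - g x\<bar> \<le> 2 * C" using fC[of x n] elim by auto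
        then show ?case using power_mono[of "\<bar>f n x - g x\<bar>" "2 * C" 2] by simp
      qed
    qed measurable
    then show "(\<lambda>n. LINT x|?M. (f n x - g x)\<^sup>2) \<longlonglongrightarrow> 0" by simp
    assume \<psi>: "smooth \<psi>"
    have [measurable]: "\<psi> \<in> borel_measurable ?M" using \<psi> by (rule smooth_measurable)
    obtain D where D: "D > 0" "\<And>x. x \<in> {a..b} \<Longrightarrow> \<bar>\<psi> x\<bar> \<le> D"
      using smooth_bounded_on_Icc[OF \<psi>] by metis
    show "(\<lambda>n. LINT x|?M. f n x * \<psi> x) \<longlonglongrightarrow> (LINT x|?M. g x * \<psi> x)"
    proof (rule integral_dominated_convergence[where w="\<lambda>x. C * D"])
      show "integrable ?M (\<lambda>x. C * D)" by (rule integrable_bounded_Ioo[where C="\<bar>C * D\<bar>"]) auto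
      show "AE x in ?M. (\<lambda>n. f n x * \<psi> x) \<longlonglongrightarrow> g x * \<psi> x"
        using fg by eventually_elim (intro tendsto_mult tendsto_const)
      show "AE x in ?M. norm (f n x * \<psi> x) \<le> C * D" for n
        using AE_space
      proof eventually_elim
        case (elim x)
        then show ?case using fC[of x n] D by (auto simp: abs_mult intro!: mult_mono)
      qed
    qed measurable
  qed
  have sm: "smooth (\<phi> n)" for n using test test_function_smooth by blast
  note v = *[OF bound(1) lim(1) meas(1) smooth_measurable[OF sm]]
  note v' = *[OF bound(2) lim(2) meas(2) smooth_measurable[OF smooth_deriv[OF sm]]]
  have "(LINT x|?M. v x * deriv \<psi> x) = - (LINT x|?M. v' x * \<psi> x)" if "test_function {a<..<b} \<psi>" for \<psi>
  proof -
    have s: "smooth \<psi>" using that test_function_smooth by blast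
    have "(\<lambda>n. LINT x|?M. \<phi> n x * deriv \<psi> x) \<longlonglongrightarrow> (LINT x|?M. v x * deriv \<psi> x)"
      using v smooth_deriv[OF s] by blast
    moreover have "(\<lambda>n. - (LINT x|?M. deriv (\<phi> n) x * \<psi> x)) \<longlonglongrightarrow> - (LINT x|?M. v' x * \<psi> x)"
      using v' s by (intro tendsto_minus) blast
    moreover have "- (LINT x|?M. deriv (\<phi> n) x * \<psi> x) = (LINT x|?M. \<phi> n x * deriv \<psi> x)" for n
      using test_function_by_parts[OF assms(1) test that] by simp
    ultimately show ?thesis using LIMSEQ_unique by simp
  qed
  then show ?thesis using v v' test unfolding H10_deriv_def H1_deriv_def by blast
qed

text \<open>Test functions vanish at \<open>b\<close>, so each is minus the integral of its
  derivative from \<open>c\<close> to \<open>b\<close>. L1 convergence of the derivatives therefore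
  forces uniform convergence of the approximating test functions; continuity, the end values and
  integration by parts from any \<open>c\<close> are inherited by the limit. The boundary term at
  \<open>b\<close> is absent since the limit is 0 there.\<close>

lemma H10_deriv_representative:
  assumes "a < b" "H10_deriv {a<..<b} u u'"
  obtains U where "continuous_on {a..b} U" "U a = 0" "U b = 0" "AE x in lebesgue_on {a<..<b}. u x = U x"
    "\<And>c g. c \<in> {a..b} \<Longrightarrow> smooth g \<Longrightarrow>
      (LINT x|lebesgue_on {a<..<b}. (if c \<le> x then u' x * g x else 0))
      = - U c * g c - (LINT x|lebesgue_on {a<..<b}. (if c \<le> x then U x * deriv g x else 0))"
proof -
  let ?M = "lebesgue_on {a<..<b}"
  obtain \<phi> where test: "\<And>n. test_function {a<..<b} (\<phi> n)"
    and lim: "(\<lambda>n. LINT x|?M. (\<phi> n x - u x)\<^sup>2) \<longlonglongrightarrow> 0"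
      "(\<lambda>n. LINT x|?M. (deriv (\<phi> n) x - u' x)\<^sup>2) \<longlonglongrightarrow> 0"
    using assms(2) by (auto simp: H10_deriv_def)
  have L2: "L2_on {a<..<b} u" "L2_on {a<..<b} u'"
    using assms(2) by (auto simp: H10_deriv_def H1_deriv_def)
  have sm: "smooth (\<phi> n)" for n using test test_function_smooth by blast
  have L2d: "L2_on {a<..<b} (\<lambda>x. \<phi> n x - u x)" "L2_on {a<..<b} (\<lambda>x. deriv (\<phi> n) x - u' x)" for n
    by (intro L2_on_diff L2_on_smooth smooth_deriv sm L2)+
  define U where "U c = - (LINT x|?M. (if c \<le> x then u' x else 0))" for c
  define \<epsilon> where "\<epsilon> n = (LINT x|?M. \<bar>deriv (\<phi> n) x - u' x\<bar>)" for n
  have \<epsilon>: "\<epsilon> \<longlonglongrightarrow> 0" unfolding \<epsilon>_def by (rule L2_tendsto_imp_L1_tendsto_Ioo[OF assms(1) L2d(2) lim(2)])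
  have int_u': "integrable ?M u'" and int_d: "integrable ?M (deriv (\<phi> n))" for n
    by (intro L2_on_imp_integrable_Ioo L2 L2_on_smooth smooth_deriv sm)+
  have \<phi>U: "\<bar>\<phi> n c - U c\<bar> \<le> \<epsilon> n" if "c \<in> {a..b}" for n c
  proof -
    have "\<phi> n c = - (LINT x|?M. (if c \<le> x then deriv (\<phi> n) x else 0))"
      using integral_deriv_Ioo[OF sm that] test_function_eq_0[OF test, of b] by simp
    then have "\<phi> n c - U c = - (LINT x|?M. (if c \<le> x then deriv (\<phi> n) x else 0) - (if c \<le> x then u' x else 0))"
      unfolding U_def using int_u' int_d
      by (subst Bochner_Integration.integral_diff) (auto intro!: integrable_restrict_ge)
    then have "\<bar>\<phi> n c - U c\<bar> \<le> (LINT x|?M. \<bar>(if c \<le> x then deriv (\<phi> n) x else 0) - (if c \<le> x then u' x else 0)\<bar>)"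
      by simp
    also have "\<dots> \<le> \<epsilon> n"
      unfolding \<epsilon>_def using int_u' int_d
      by (intro integral_mono) (auto intro!: integrable_restrict_ge integrable_abs Bochner_Integration.integrable_diff)
    finally show ?thesis .
  qed
  have unif: "uniform_limit {a..b} \<phi> U sequentially"
  proof (rule uniform_limitI)
    fix r :: real assume "r > 0"
    then have "\<forall>\<^sub>F n in sequentially. \<epsilon> n < r" using \<epsilon> by (rule order_tendstoD(2)[rotated])
    then show "\<forall>\<^sub>F n in sequentially. \<forall>x\<in>{a..b}. dist (\<phi> n x) (U x) < r"
    proof eventually_elim
      case (elim n)
      then show ?case using \<phi>U[of _ n] by (fastforce simp: dist_real_def)
    qed
  qed
  have contU: "continuous_on {a..b} U"
    by (rule uniform_limit_theorem[OF _ unif]) (auto intro!: always_eventually smooth_imp_continuous_on sm)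
  have "compact (U ` {a..b})" using contU by (intro compact_continuous_image) auto
  then obtain C where C: "\<And>x. x \<in> {a..b} \<Longrightarrow> \<bar>U x\<bar> \<le> C"
    by (metis bounded_real compact_imp_bounded imageI)
  have measU: "U \<in> borel_measurable ?M"
    by (rule continuous_on_Icc_imp_measurable_Ioo[OF contU])
  have L2U: "L2_on {a<..<b} U"
    by (rule L2_on_bounded_Ioo[OF measU, of C]) (use C in \<open>auto intro!: AE_I2\<close>)
  have lim_at: "(\<lambda>n. \<phi> n c) \<longlonglongrightarrow> U c" if "c \<in> {a..b}" for c
    using tendsto_uniform_limitI[OF unif that] .
  have "U a = 0" "U b = 0"
    using lim_at[of a] lim_at[of b] test_function_eq_0[OF test, of a] test_function_eq_0[OF test, of b] assms(1)
    by (auto simp: LIMSEQ_const_iff)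
  \<comment> \<open>Triangle inequality through the \<open>n\<close>-th approximation: close to
    \<open>u\<close> in L1 and uniformly within \<open>\<epsilon> n\<close> of \<open>U\<close>. As
    the left side does not depend on \<open>n\<close>, it must be 0.\<close>
  have "(LINT x|?M. \<bar>u x - U x\<bar>) \<le> (LINT x|?M. \<bar>\<phi> n x - u x\<bar>) + (b - a) * \<epsilon> n" for n
  proof -
    interpret finite_measure ?M by (rule finite_measure_lebesgue_on_Ioo)
    have m: "measure ?M {a<..<b} = b - a"
      using assms(1) by (simp add: measure_restrict_space)
    have "(LINT x|?M. \<bar>u x - U x\<bar>) \<le> (LINT x|?M. \<bar>\<phi> n x - u x\<bar> + \<epsilon> n)"
    proof (rule integral_mono)
      show "integrable ?M (\<lambda>x. \<bar>u x - U x\<bar>)" "integrable ?M (\<lambda>x. \<bar>\<phi> n x - u x\<bar> + \<epsilon> n)"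
        using L2_on_imp_integrable_Ioo[OF L2_on_diff[OF L2(1) L2U]] L2_on_imp_integrable_Ioo[OF L2d(1)] by auto
      show "\<bar>u x - U x\<bar> \<le> \<bar>\<phi> n x - u x\<bar> + \<epsilon> n" if "x \<in> space ?M" for x
        using \<phi>U[of x n] that by auto
    qed
    also have "\<dots> = (LINT x|?M. \<bar>\<phi> n x - u x\<bar>) + (b - a) * \<epsilon> n"
      using L2_on_imp_integrable_Ioo[OF L2d(1)] m by simp
    finally show ?thesis .
  qed
  moreover have "(\<lambda>n. (LINT x|?M. \<bar>\<phi> n x - u x\<bar>) + (b - a) * \<epsilon> n) \<longlonglongrightarrow> 0 + (b - a) * 0"
    by (intro tendsto_add tendsto_mult tendsto_const \<epsilon> L2_tendsto_imp_L1_tendsto_Ioo[OF assms(1) L2d(1) lim(1)])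
  ultimately have "(LINT x|?M. \<bar>u x - U x\<bar>) \<le> 0"
    by (intro LIMSEQ_le_const) auto
  moreover have "(LINT x|?M. \<bar>u x - U x\<bar>) \<ge> 0" by (intro integral_nonneg_AE) auto
  ultimately have "(LINT x|?M. \<bar>u x - U x\<bar>) = 0" by simp
  then have aeU: "AE x in ?M. u x = U x"
    using integral_nonneg_eq_0_iff_AE[of ?M "\<lambda>x. \<bar>u x - U x\<bar>"]
      L2_on_imp_integrable_Ioo[OF L2_on_diff[OF L2(1) L2U]] by simp
  have parts: "(LINT x|?M. (if c \<le> x then u' x * g x else 0))
      = - U c * g c - (LINT x|?M. (if c \<le> x then U x * deriv g x else 0))"
    if c: "c \<in> {a..b}" and g: "smooth g" for c g
  proof -
    \<comment> \<open>L1 convergence is enough here because the smooth factor is bounded on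
      \<open>{a..b}\<close>. The claim serves for the derivatives with limit \<open>u'\<close> and
      for the functions with limit \<open>U\<close>.\<close>
    have conv: "(\<lambda>n. LINT x|?M. (if c \<le> x then f n x * \<psi> x else 0)) \<longlonglongrightarrow> (LINT x|?M. (if c \<le> x then F x * \<psi> x else 0))"
      if f: "\<And>n. L2_on {a<..<b} (f n)" and F: "L2_on {a<..<b} F" and \<psi>: "smooth \<psi>"
        and l: "(\<lambda>n. LINT x|?M. \<bar>f n x - F x\<bar>) \<longlonglongrightarrow> 0" for f F \<psi>
    proof -
      obtain D where D: "D > 0" "\<And>x. x \<in> {a..b} \<Longrightarrow> \<bar>\<psi> x\<bar> \<le> D"
        using smooth_bounded_on_Icc[OF \<psi>] by metis
      have i: "integrable ?M (\<lambda>x. if c \<le> x then f n x * \<psi> x else 0)"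
        "integrable ?M (\<lambda>x. if c \<le> x then F x * \<psi> x else 0)" for n
        by (rule integrable_restrict_ge[OF L2_on_mult_integrable[OF f L2_on_smooth[OF \<psi>]]],
            rule integrable_restrict_ge[OF L2_on_mult_integrable[OF F L2_on_smooth[OF \<psi>]]])
      have est: "\<bar>(LINT x|?M. (if c \<le> x then f n x * \<psi> x else 0)) - (LINT x|?M. (if c \<le> x then F x * \<psi> x else 0))\<bar>
          \<le> D * (LINT x|?M. \<bar>f n x - F x\<bar>)" for n
      proof -
        have "\<bar>(LINT x|?M. (if c \<le> x then f n x * \<psi> x else 0)) - (LINT x|?M. (if c \<le> x then F x * \<psi> x else 0))\<bar>
            = \<bar>LINT x|?M. (if c \<le> x then f n x * \<psi> x else 0) - (if c \<le> x then F x * \<psi> x else 0)\<bar>"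
          using i by simp
        also have "\<dots> \<le> (LINT x|?M. \<bar>(if c \<le> x then f n x * \<psi> x else 0) - (if c \<le> x then F x * \<psi> x else 0)\<bar>)"
          by simp
        also have "\<dots> \<le> (LINT x|?M. D * \<bar>f n x - F x\<bar>)"
        proof (rule integral_mono)
          show "integrable ?M (\<lambda>x. \<bar>(if c \<le> x then f n x * \<psi> x else 0) - (if c \<le> x then F x * \<psi> x else 0)\<bar>)"
            using i by (intro integrable_abs Bochner_Integration.integrable_diff)
          show "integrable ?M (\<lambda>x. D * \<bar>f n x - F x\<bar>)"
            using L2_on_imp_integrable_Ioo[OF L2_on_diff[OF f F]] by simp
          show "\<bar>(if c \<le> x then f n x * \<psi> x else 0) - (if c \<le> x then F x * \<psi> x else 0)\<bar> \<le> D * \<bar>f n x - F x\<bar>"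
            if "x \<in> space ?M" for x
          proof -
            have "\<bar>f n x * \<psi> x - F x * \<psi> x\<bar> = \<bar>\<psi> x\<bar> * \<bar>f n x - F x\<bar>"
              by (simp add: abs_mult[symmetric] algebra_simps)
            also have "\<dots> \<le> D * \<bar>f n x - F x\<bar>"
              using D that by (intro mult_right_mono) auto
            finally show ?thesis using D by auto
          qed
        qed
        also have "\<dots> = D * (LINT x|?M. \<bar>f n x - F x\<bar>)" by simp
        finally show ?thesis .
      qed
      have lim0: "(\<lambda>n. D * (LINT x|?M. \<bar>f n x - F x\<bar>)) \<longlonglongrightarrow> 0"
        using tendsto_mult[OF tendsto_const[of D] l] by simp
      show ?thesis
        by (rule LIM_zero_cancel, rule Lim_null_comparison[OF _ lim0])
           (simp only: real_norm_def est always_eventually simp_thms)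
    qed
    have lU: "(\<lambda>n. LINT x|?M. \<bar>\<phi> n x - U x\<bar>) \<longlonglongrightarrow> 0"
    proof -
      have "(LINT x|?M. \<bar>\<phi> n x - u x\<bar>) = (LINT x|?M. \<bar>\<phi> n x - U x\<bar>)" for n
        using aeU L2(1) smooth_measurable[OF sm] measU by (intro integral_cong_AE) (auto simp: L2_on_def)
      then show ?thesis using L2_tendsto_imp_L1_tendsto_Ioo[OF assms(1) L2d(1) lim(1)] by simp
    qed
    have "(\<lambda>n. LINT x|?M. (if c \<le> x then deriv (\<phi> n) x * g x else 0))
        \<longlonglongrightarrow> (LINT x|?M. (if c \<le> x then u' x * g x else 0))"
      using \<epsilon> unfolding \<epsilon>_def by (intro conv L2_on_smooth smooth_deriv sm L2 g)
    moreover have "(\<lambda>n. - \<phi> n c * g c - (LINT x|?M. (if c \<le> x then \<phi> n x * deriv g x else 0)))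
        \<longlonglongrightarrow> - U c * g c - (LINT x|?M. (if c \<le> x then U x * deriv g x else 0))"
      by (intro tendsto_diff tendsto_mult tendsto_minus tendsto_const lim_at c conv
          L2_on_smooth smooth_deriv sm g L2U lU)
    moreover have "(LINT x|?M. (if c \<le> x then deriv (\<phi> n) x * g x else 0))
        = - \<phi> n c * g c - (LINT x|?M. (if c \<le> x then \<phi> n x * deriv g x else 0))" for n
      using integral_by_parts_Ioo[OF sm g c, of n] test_function_eq_0[OF test, of b] by simp
    ultimately show ?thesis using LIMSEQ_unique by simp
  qed
  show ?thesis using that contU \<open>U a = 0\<close> \<open>U b = 0\<close> aeU parts by blast
qed

section \<open>Cutoffs whose products keep bounded derivatives\<close>

lemma smooth_lipschitz:
  assumes "smooth f"
  obtains L where "L > 0" "\<And>x y. x \<in> {a..b} \<Longrightarrow> y \<in> {a..b} \<Longrightarrow> \<bar>f x - f y\<bar> \<le> L * \<bar>x - y\<bar>"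
proof -
  obtain L where L: "L > 0" "\<And>x. x \<in> {a..b} \<Longrightarrow> \<bar>deriv f x\<bar> \<le> L"
    using smooth_bounded_on_Icc[OF smooth_deriv[OF assms]] by metis
  have "norm (f x - f y) \<le> L * norm (x - y)" if "x \<in> {a..b}" "y \<in> {a..b}" for x y
    by (rule field_differentiable_bound[of "{a..b}" f "deriv f"])
       (use L that in \<open>auto intro: has_field_derivative_at_within smooth_imp_DERIV[OF assms]\<close>)
  with L(1) show ?thesis using that[of L] by simp
qed

lemma DERIV_mult_smooth_step:
  assumes "(f has_real_derivative f') (at x)"
  shows "((\<lambda>x. f x * smooth_step (r * x + q)) has_real_derivative
      f' * smooth_step (r * x + q) + f x * (r * deriv smooth_step (r * x + q))) (at x)"
proof -
  have "((\<lambda>x. smooth_step (r * x + q)) has_real_derivative deriv smooth_step (r * x + q) * r) (at x)"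
    by (rule DERIV_chain2[OF smooth_imp_DERIV[OF smooth_smooth_step]]) (auto intro!: derivative_eq_intros)
  from DERIV_mult[OF assms this] show ?thesis by (simp add: algebra_simps)
qed

text \<open>The rescaled step varies only for \<open>r * t\<close> between 1 and 2. There
  \<open>\<bar>y\<bar>\<close> is at most \<open>2 * L / r\<close>, which cancels the slope factor
  \<open>r\<close>; the bound is thus independent of \<open>r\<close>.\<close>

lemma abs_mult_deriv_smooth_step_le:
  assumes M: "\<And>t. \<bar>deriv smooth_step t\<bar> \<le> M" and "\<bar>y\<bar> \<le> L * \<bar>t\<bar>" "L \<ge> 0" "r > 0"
  shows "\<bar>y * (r * deriv smooth_step (r * t - 1))\<bar> \<le> 2 * L * M"
proof (cases "0 \<le> r * t - 1 \<and> r * t - 1 \<le> 1")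
  case True
  have M0: "M \<ge> 0" using M[of 0] by linarith
  have t: "t \<ge> 0"
  proof (rule ccontr)
    assume "\<not> t \<ge> 0"
    then have "r * t \<le> 0" using assms(4) by (simp add: mult_nonneg_nonpos)
    then show False using True by linarith
  qed
  have "\<bar>y\<bar> * r \<le> (L * t) * r" using assms t by (intro mult_right_mono) auto
  also have "\<dots> = L * (r * t)" by simp
  also have "\<dots> \<le> L * 2" using True assms by (intro mult_left_mono) auto
  finally have "\<bar>y\<bar> * r * \<bar>deriv smooth_step (r * t - 1)\<bar> \<le> (L * 2) * M"
    using M0 M assms(3) by (rule_tac mult_mono) auto
  then show ?thesis using assms(4) by (simp add: abs_mult mult.assoc mult.left_commute)
next
  case False
  then have "deriv smooth_step (r * t - 1) = 0" by (intro deriv_smooth_step_eq_0) auto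
  moreover have "M \<ge> 0" using M[of 0] by linarith
  ultimately show ?thesis using assms by simp
qed

lemma AE_neq_Ioo: "AE x in lebesgue_on {a<..<b::real}. x \<noteq> c"
proof -
  have "AE x in lebesgue. x \<noteq> c" by (intro AE_completion AE_lborel_singleton)
  then show ?thesis by (subst AE_restrict_space_iff) auto
qed

text \<open>A nonempty open interval is not a null set. This turns almost-everywhere statements into
  points or contradictions.\<close>

lemma AE_Ioo_ex:
  fixes a b c d :: real
  assumes "AE x in lebesgue_on {a<..<b}. P x" "a \<le> c" "c < d" "d \<le> b"
  shows "\<exists>x\<in>{c<..<d}. P x"
proof (rule ccontr)
  assume *: "\<not> ?thesis"
  have "AE x in lebesgue. x \<in> {a<..<b} \<longrightarrow> P x"
    using assms(1) by (subst (asm) AE_restrict_space_iff) auto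
  then have "AE x in lebesgue. x \<notin> {c<..<d}"
    by eventually_elim (use * assms in auto)
  then have "negligible {c<..<d}"
    by (simp add: negligible_iff_null_sets AE_iff_null_sets)
  then show False using open_not_negligible[of "{c<..<d}"] assms by auto
qed

text \<open>Near \<open>b\<close> the cutoff has slope of order \<open>r\<close>, but there \<open>S + T\<close> is of order \<open>1 / r\<close>; likewise
  for \<open>S\<close> near \<open>c\<close> and \<open>T\<close> near \<open>d\<close>. So the derivatives of the approximations stay bounded.\<close>

lemma H10_deriv_two_pieces:
  assumes ab: "a < b" and S: "smooth S" and T: "smooth T" and c: "c \<in> {a..<b}" and d: "d \<in> {a..<b}"
    and "S c = 0" "T d = 0" "S b + T b = 0"
  shows "H10_deriv {a<..<b} (\<lambda>x. (if c \<le> x then S x else 0) + (if d \<le> x then T x else 0))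
      (\<lambda>x. (if c \<le> x then deriv S x else 0) + (if d \<le> x then deriv T x else 0))"
proof -
  \<comment> \<open>The left cutoffs rise between \<open>q + 1 / r n\<close> and
    \<open>q + 2 / r n\<close> for \<open>q\<close> equal to \<open>c\<close> or \<open>d\<close>,
    and the right one falls between \<open>b - 2 / r n\<close> and \<open>b - 1 / r n\<close>.
    Keeping \<open>r n * (b - q)\<close> at least 5 separates these zones from the first
    \<open>n\<close> on.\<close>
  define R where "R = 5 / (b - c) + 5 / (b - d)"
  define r where "r n = real n + R" for n
  have R: "R > 0" "R * (b - c) \<ge> 5" "R * (b - d) \<ge> 5"
  proof -
    have "b - c > 0" "b - d > 0" using c d by auto
    then have "5 / (b - c) > 0" "5 / (b - d) > 0" "5 / (b - c) * (b - c) = 5" "5 / (b - d) * (b - d) = 5"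
      "5 / (b - d) * (b - c) \<ge> 0" "5 / (b - c) * (b - d) \<ge> 0"
      by (simp_all add: divide_simps)
    then show "R > 0" "R * (b - c) \<ge> 5" "R * (b - d) \<ge> 5"
      unfolding R_def distrib_right by linarith+
  qed
  have r: "r n > 0" "r n * (b - c) \<ge> 5" "r n * (b - d) \<ge> 5" for n
  proof -
    show "r n > 0" using R by (simp add: r_def add_nonneg_pos)
    have "R * t \<le> r n * t" if "t \<ge> 0" for t
      using that by (intro mult_right_mono) (simp_all add: r_def)
    then show "r n * (b - c) \<ge> 5" "r n * (b - d) \<ge> 5"
      using c d by (auto intro: order_trans[OF R(2)] order_trans[OF R(3)])
  qed
  \<comment> \<open>The shift by 1 in the argument leaves a gap of width \<open>1 / r n\<close>
    where the cutoff is 0, so that the support is compact inside the open interval even if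
    \<open>c\<close> or \<open>d\<close> equals \<open>a\<close>.\<close>
  define \<sigma> where "\<sigma> n q x = smooth_step (r n * x + (- r n * q - 1))" for n q x
  define \<tau> where "\<tau> n x = smooth_step ((- r n) * x + (r n * b - 1))" for n x
  define \<sigma>' where "\<sigma>' n q x = r n * deriv smooth_step (r n * (x - q) - 1)" for n q x
  define \<tau>' where "\<tau>' n x = - (r n * deriv smooth_step (r n * (b - x) - 1))" for n x
  have \<sigma>: "\<sigma> n q x = smooth_step (r n * (x - q) - 1)" for n q x
    by (simp add: \<sigma>_def algebra_simps)
  have \<tau>: "\<tau> n x = smooth_step (r n * (b - x) - 1)" for n x
    by (simp add: \<tau>_def algebra_simps)
  define G where "G n x = S x * \<sigma> n c x + T x * \<sigma> n d x" for n x
  define G' where "G' n x = (deriv S x * \<sigma> n c x + S x * \<sigma>' n c x) + (deriv T x * \<sigma> n d x + T x * \<sigma>' n d x)"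
    for n x
  define \<phi> where "\<phi> n x = G n x * \<tau> n x" for n x
  have DG: "(G n has_real_derivative G' n x) (at x)" for n x
  proof -
    have "((\<lambda>x. f x * \<sigma> n q x) has_real_derivative deriv f x * \<sigma> n q x + f x * \<sigma>' n q x) (at x)"
      if "smooth f" for f q
      using DERIV_mult_smooth_step[OF smooth_imp_DERIV[OF that], where r="r n" and q="- r n * q - 1"]
      unfolding \<sigma>_def \<sigma>'_def by (simp add: algebra_simps)
    from DERIV_add[OF this[OF S] this[OF T]] show ?thesis unfolding G_def[abs_def] G'_def .
  qed
  have D\<phi>: "deriv (\<phi> n) x = G' n x * \<tau> n x + G n x * \<tau>' n x" for n x
    using DERIV_mult_smooth_step[OF DG, where r="- r n" and q="r n * b - 1", THEN DERIV_imp_deriv]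
    unfolding \<phi>_def[abs_def] \<tau>_def \<tau>'_def by (simp add: algebra_simps)
  have sm: "smooth (\<phi> n)" for n
    unfolding \<phi>_def[abs_def] G_def \<sigma>_def \<tau>_def
    by (intro smooth_mult smooth_add S T smooth_affine[OF smooth_smooth_step])
  have test: "test_function {a<..<b} (\<phi> n)" for n
  proof -
    have "{x. \<phi> n x \<noteq> 0} \<subseteq> {a + 1 / r n..b - 1 / r n}"
    proof (rule subsetI, rule ccontr)
      fix x assume x: "x \<in> {x. \<phi> n x \<noteq> 0}" "x \<notin> {a + 1 / r n..b - 1 / r n}"
      have "r n * (b - x) - 1 < 0 \<or> r n * (x - a) - 1 < 0"
        using x(2) r(1)[of n] by (auto simp: field_simps)
      then show False
      proof
        assume "r n * (b - x) - 1 < 0"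
        then have "\<tau> n x = 0" by (simp add: \<tau> smooth_step_eq_0)
        then show False using x(1) by (simp add: \<phi>_def)
      next
        assume *: "r n * (x - a) - 1 < 0"
        have "\<sigma> n q x = 0" if "a \<le> q" for q
        proof -
          have "r n * (x - q) \<le> r n * (x - a)" using that r(1)[of n] by (intro mult_left_mono) auto
          then show ?thesis using * by (simp add: \<sigma> smooth_step_eq_0)
        qed
        then have "\<sigma> n c x = 0" "\<sigma> n d x = 0" using c d by auto
        then show False using x(1) by (simp add: \<phi>_def G_def)
      qed
    qed
    then have *: "closure {x. \<phi> n x \<noteq> 0} \<subseteq> {a + 1 / r n..b - 1 / r n}"
      by (rule closure_minimal) simp
    then have "bounded {x. \<phi> n x \<noteq> 0}"
      using bounded_closed_interval bounded_subset closure_subset subset_trans by metis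
    moreover have "{a + 1 / r n..b - 1 / r n} \<subseteq> {a<..<b}"
    proof -
      have "1 / r n > 0" using r(1)[of n] by simp
      then have "a < x \<and> x < b" if "a + 1 / r n \<le> x" "x \<le> b - 1 / r n" for x
        using that by linarith
      then show ?thesis by auto
    qed
    ultimately show ?thesis
      unfolding test_function_def using sm * by (auto simp: smooth_iff compact_closure)
  qed
  obtain M where M: "M > 0" "\<And>t. \<bar>deriv smooth_step t\<bar> \<le> M"
    using deriv_smooth_step_bounded by metis
  have bnd: "\<exists>K. \<forall>x\<in>{a..b}. \<bar>f x\<bar> \<le> K" if "smooth f" for f
    using smooth_bounded_on_Icc[OF that] by metis
  obtain B1 where B1: "\<And>x. x \<in> {a..b} \<Longrightarrow> \<bar>S x\<bar> \<le> B1" using bnd[OF S] by blast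
  obtain B2 where B2: "\<And>x. x \<in> {a..b} \<Longrightarrow> \<bar>T x\<bar> \<le> B2" using bnd[OF T] by blast
  obtain B3 where B3: "\<And>x. x \<in> {a..b} \<Longrightarrow> \<bar>deriv S x\<bar> \<le> B3" using bnd[OF smooth_deriv[OF S]] by blast
  obtain B4 where B4: "\<And>x. x \<in> {a..b} \<Longrightarrow> \<bar>deriv T x\<bar> \<le> B4" using bnd[OF smooth_deriv[OF T]] by blast
  obtain L1 where L1: "L1 > 0" "\<And>x y. x \<in> {a..b} \<Longrightarrow> y \<in> {a..b} \<Longrightarrow> \<bar>S x - S y\<bar> \<le> L1 * \<bar>x - y\<bar>"
    using smooth_lipschitz[OF S] by metis
  obtain L2 where L2: "L2 > 0" "\<And>x y. x \<in> {a..b} \<Longrightarrow> y \<in> {a..b} \<Longrightarrow> \<bar>T x - T y\<bar> \<le> L2 * \<bar>x - y\<bar>"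
    using smooth_lipschitz[OF T] by metis
  have step1: "\<bar>y * smooth_step t\<bar> \<le> \<bar>y\<bar>" for y t
    using smooth_step_bounds[of t] by (simp add: abs_mult mult_left_le)
  have G_bound: "\<bar>G n x\<bar> \<le> B1 + B2" if "x \<in> {a..b}" for n x
    using step1[of "S x"] step1[of "T x"] B1[OF that] B2[OF that] abs_triangle_ineq
    unfolding G_def \<sigma> by (meson add_mono order_trans)
  have G'_bound: "\<bar>G' n x\<bar> \<le> (B3 + 2 * L1 * M) + (B4 + 2 * L2 * M)" if x: "x \<in> {a..b}" for n x
  proof -
    have "\<bar>S x * \<sigma>' n c x\<bar> \<le> 2 * L1 * M" unfolding \<sigma>'_def
      by (rule abs_mult_deriv_smooth_step_le[OF M(2)])
         (use L1(2)[OF x, of c] L1(1) c r assms in auto)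
    moreover have "\<bar>T x * \<sigma>' n d x\<bar> \<le> 2 * L2 * M" unfolding \<sigma>'_def
      by (rule abs_mult_deriv_smooth_step_le[OF M(2)])
         (use L2(2)[OF x, of d] L2(1) d r assms in auto)
    moreover have "\<bar>deriv S x * \<sigma> n c x\<bar> \<le> B3" "\<bar>deriv T x * \<sigma> n d x\<bar> \<le> B4"
      using step1 B3[OF x] B4[OF x] unfolding \<sigma> by (meson order_trans)+
    ultimately show ?thesis unfolding G'_def by linarith
  qed
  have G_right: "\<sigma> n q x = 1" "\<sigma>' n q x = 0" if "r n * (x - q) > 2" for n q x
    using that by (simp_all add: \<sigma> \<sigma>'_def smooth_step_eq_1 deriv_smooth_step_eq_0)
  have G_left: "\<sigma> n q x = 0" "\<sigma>' n q x = 0" if "x < q" for n q x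
  proof -
    have "r n * (x - q) \<le> 0" using that r(1)[of n] by (simp add: mult_nonneg_nonpos)
    then show "\<sigma> n q x = 0" "\<sigma>' n q x = 0"
      by (simp_all add: \<sigma> \<sigma>'_def smooth_step_eq_0 deriv_smooth_step_eq_0)
  qed
  have \<tau>_bound: "\<bar>G n x * \<tau>' n x\<bar> \<le> 2 * (L1 + L2) * M" if x: "x \<in> {a..b}" for n x
  proof (cases "r n * (b - x) \<le> 2")
    case True
    \<comment> \<open>Since 5 - 2 > 2, both left cutoffs are already 1 here. What the right cutoff
      multiplies is \<open>S + T\<close>, which vanishes at \<open>b\<close> although neither
      summand has to.\<close>
    have "r n * (x - c) > 2" "r n * (x - d) > 2"
      using True r[of n] by (simp_all add: algebra_simps)
    then have "G n x = S x + T x" by (simp add: G_def G_right)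
    also have "\<dots> = (S x - S b) + (T x - T b)" using assms by simp
    finally have "\<bar>G n x\<bar> \<le> (L1 + L2) * \<bar>b - x\<bar>"
      using L1(2)[OF x, of b] L2(2)[OF x, of b] ab by (simp add: distrib_right abs_minus_commute)
    then have "\<bar>G n x * (r n * deriv smooth_step (r n * (b - x) - 1))\<bar> \<le> 2 * (L1 + L2) * M"
      by (rule abs_mult_deriv_smooth_step_le[OF M(2)]) (use L1 L2 r in auto)
    then show ?thesis by (simp add: \<tau>'_def)
  next
    case False
    then show ?thesis using L1 L2 M by (simp add: \<tau>'_def deriv_smooth_step_eq_0)
  qed
  define C where "C = (B1 + B2) + ((B3 + 2 * L1 * M) + (B4 + 2 * L2 * M)) + 2 * (L1 + L2) * M"
  have nonneg: "B1 + B2 \<ge> 0" "(B3 + 2 * L1 * M) + (B4 + 2 * L2 * M) \<ge> 0" "2 * (L1 + L2) * M \<ge> 0"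
    using G_bound[of a 0] G'_bound[of a 0] \<tau>_bound[of a 0] ab by (auto intro: order_trans[OF abs_ge_zero])
  have large: "\<forall>\<^sub>F n in sequentially. r n * t > 2" if "t > 0" for t
  proof -
    have "filterlim r at_top sequentially"
      by (rule filterlim_at_top_mono[OF filterlim_real_sequentially]) (use R in \<open>simp add: r_def\<close>)
    then have "\<forall>\<^sub>F n in sequentially. r n > 2 / t" by (rule filterlim_at_top_dense[THEN iffD1, rule_format])
    then show ?thesis by eventually_elim (use that in \<open>simp add: field_simps\<close>)
  qed
  have ev: "\<forall>\<^sub>F n in sequentially. \<sigma> n q x = (if q \<le> x then 1 else 0) \<and> \<sigma>' n q x = 0" if "x \<noteq> q" for q x
  proof (cases "q \<le> x")
    case True
    with large[of "x - q"] that show ?thesis by (auto elim!: eventually_mono simp: G_right)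
  next
    case False
    then show ?thesis using G_left[of x q] by auto
  qed
  have ev\<tau>: "\<forall>\<^sub>F n in sequentially. \<tau> n x = 1 \<and> \<tau>' n x = 0" if "x < b" for x
    using large[of "b - x"] that
    by (auto elim!: eventually_mono simp: \<tau> \<tau>'_def smooth_step_eq_1 deriv_smooth_step_eq_0)
  \<comment> \<open>Away from \<open>c\<close> and \<open>d\<close> the approximations are not
    merely convergent but eventually equal to the glued function; the two exceptional points form a
    null set.\<close>
  have lim: "\<forall>\<^sub>F n in sequentially.
      \<phi> n x = (if c \<le> x then S x else 0) + (if d \<le> x then T x else 0)
      \<and> deriv (\<phi> n) x = (if c \<le> x then deriv S x else 0) + (if d \<le> x then deriv T x else 0)"
    if "x \<noteq> c" "x \<noteq> d" "x < b" for x
    using ev[OF that(1)] ev[OF that(2)] ev\<tau>[OF that(3)]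
    by eventually_elim (simp add: D\<phi> \<phi>_def G_def G'_def)
  have AE_lim: "AE x in lebesgue_on {a<..<b}. x \<noteq> c \<and> x \<noteq> d \<and> x < b"
    using AE_neq_Ioo[where c=c] AE_neq_Ioo[where c=d] AE_space by eventually_elim auto
  show ?thesis
  proof (rule H10_derivI_dominated[OF ab test, where C=C])
    fix n x assume "x \<in> {a<..<b}"
    then have x: "x \<in> {a..b}" by auto
    have "\<bar>\<phi> n x\<bar> \<le> B1 + B2"
      using step1 G_bound[OF x] unfolding \<phi>_def \<tau> by (meson order_trans)
    then show "\<bar>\<phi> n x\<bar> \<le> C" unfolding C_def using nonneg by linarith
    have "\<bar>G' n x * \<tau> n x\<bar> \<le> (B3 + 2 * L1 * M) + (B4 + 2 * L2 * M)"
      using step1 G'_bound[OF x] unfolding \<tau> by (meson order_trans)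
    then show "\<bar>deriv (\<phi> n) x\<bar> \<le> C" unfolding D\<phi> C_def using nonneg \<tau>_bound[OF x, of n] by linarith
  next
    show "AE x in lebesgue_on {a<..<b}.
        (\<lambda>n. \<phi> n x) \<longlonglongrightarrow> (if c \<le> x then S x else 0) + (if d \<le> x then T x else 0)"
      using AE_lim
    proof eventually_elim
      case (elim x)
      then show ?case by (intro tendsto_eventually eventually_mono[OF lim[of x]]) auto
    qed
    show "AE x in lebesgue_on {a<..<b}.
        (\<lambda>n. deriv (\<phi> n) x) \<longlonglongrightarrow> (if c \<le> x then deriv S x else 0) + (if d \<le> x then deriv T x else 0)"
      using AE_lim
    proof eventually_elim
      case (elim x)
      then show ?case by (intro tendsto_eventually eventually_mono[OF lim[of x]]) auto
    qed
  qed (intro borel_measurable_add measurable_restrict_ge smooth_measurable smooth_deriv S T)+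
qed

section \<open>Sine arcs as test functions and the Dirichlet eigenpairs\<close>

definition sine_from :: "real \<Rightarrow> real \<Rightarrow> real \<Rightarrow> real" where
  "sine_from \<omega> c x = (if c \<le> x then sin (\<omega> * (x - c)) else 0)"

lemma smooth_sine: "smooth (\<lambda>x. A * sin (\<omega> * (x - c)))"
proof -
  have "smooth (\<lambda>x. A * sin (\<omega> * x + - (\<omega> * c)))"
    by (rule smooth_mult[OF smooth_const smooth_affine[OF smooth_sin]])
  then show ?thesis by (simp add: algebra_simps)
qed

lemma smooth_cosine: "smooth (\<lambda>x. A * cos (\<omega> * (x - c)))"
proof -
  have "smooth (\<lambda>x. A * cos (\<omega> * x + - (\<omega> * c)))"
    by (rule smooth_mult[OF smooth_const smooth_affine[OF smooth_cos]])
  then show ?thesis by (simp add: algebra_simps)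
qed

lemma deriv_sine: "deriv (\<lambda>x. A * sin (\<omega> * (x - c))) = (\<lambda>x. A * \<omega> * cos (\<omega> * (x - c)))"
  by (rule ext, rule DERIV_imp_deriv) (auto intro!: derivative_eq_intros)

lemma deriv_cosine: "deriv (\<lambda>x. A * cos (\<omega> * (x - c))) = (\<lambda>x. - (A * \<omega> * sin (\<omega> * (x - c))))"
  by (rule ext, rule DERIV_imp_deriv) (auto intro!: derivative_eq_intros)

text \<open>The distribution \<open>-(sine_from \<omega> c)''\<close> is \<open>\<omega>\<^sup>2 sine_from \<omega> c - \<omega> \<delta>\<^sub>c\<close>, so these functions act
  as fundamental solutions of the eigenvalue equation.\<close>

lemma H10_deriv_sine_from:
  assumes "a < b" "c \<in> {a..<b}" "d \<in> {a..<b}" "A * sin (\<omega> * (b - c)) + B * sin (\<omega> * (b - d)) = 0"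
  shows "H10_deriv {a<..<b} (\<lambda>x. A * sine_from \<omega> c x + B * sine_from \<omega> d x)
      (\<lambda>x. (if c \<le> x then A * \<omega> * cos (\<omega> * (x - c)) else 0)
         + (if d \<le> x then B * \<omega> * cos (\<omega> * (x - d)) else 0))"
proof -
  have "(\<lambda>x. (if c \<le> x then A * sin (\<omega> * (x - c)) else 0) + (if d \<le> x then B * sin (\<omega> * (x - d)) else 0))
      = (\<lambda>x. A * sine_from \<omega> c x + B * sine_from \<omega> d x)"
    by (auto simp: sine_from_def)
  then show ?thesis
    using H10_deriv_two_pieces[OF assms(1) smooth_sine smooth_sine assms(2,3), of A \<omega> c B \<omega> d] assms(4)
    unfolding deriv_sine by simp
qed

lemma sine_from_integrable:
  assumes "continuous_on {a..b} U"
  shows "integrable (lebesgue_on {a<..<b}) (\<lambda>x. U x * sine_from \<omega> c x)"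
proof -
  have "compact (U ` {a..b})" using assms by (intro compact_continuous_image) auto
  then obtain C where C: "\<And>x. x \<in> {a..b} \<Longrightarrow> \<bar>U x\<bar> \<le> C"
    by (metis bounded_real compact_imp_bounded imageI)
  have [measurable]: "U \<in> borel_measurable (lebesgue_on {a<..<b})"
    by (rule continuous_on_Icc_imp_measurable_Ioo[OF assms])
  have "smooth (\<lambda>x. sin (\<omega> * (x - c)))" using smooth_sine[of 1] by simp
  then have [measurable]: "sine_from \<omega> c \<in> borel_measurable (lebesgue_on {a<..<b})"
    unfolding sine_from_def[abs_def] by (intro measurable_restrict_ge smooth_measurable)
  show ?thesis
  proof (rule integrable_bounded_Ioo[where C=C])
    show "AE x in lebesgue_on {a<..<b}. \<bar>U x * sine_from \<omega> c x\<bar> \<le> C"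
      using AE_space
    proof eventually_elim
      case (elim x)
      then have "\<bar>U x\<bar> \<le> C" by (intro C) auto
      moreover from this have "C \<ge> 0" by linarith
      ultimately have "\<bar>U x\<bar> * \<bar>sine_from \<omega> c x\<bar> \<le> C * 1"
        by (intro mult_mono) (auto simp: sine_from_def)
      then show ?case by (simp add: abs_mult)
    qed
  qed measurable
qed

text \<open>Integrating by parts from each kink turns the cosine into \<open>\<omega>\<close> times
  a sine; since \<open>cos 0 = 1\<close>, the kinks contribute the values of \<open>U\<close> at
  \<open>c\<close> and \<open>d\<close>. The pair \<open>U\<close>, \<open>u'\<close> is kept
  general so that it can be a solution or, when a sine is verified to be an eigenfunction, the test
  function.\<close>

lemma H10_inner_sine_from:
  assumes "a < b" "c \<in> {a..b}" "d \<in> {a..b}" "L2_on {a<..<b} u'" "continuous_on {a..b} U"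
    and parts: "\<And>c g. c \<in> {a..b} \<Longrightarrow> smooth g \<Longrightarrow>
      (LINT x|lebesgue_on {a<..<b}. (if c \<le> x then u' x * g x else 0))
      = - U c * g c - (LINT x|lebesgue_on {a<..<b}. (if c \<le> x then U x * deriv g x else 0))"
  shows "(LINT x|lebesgue_on {a<..<b}. u' x * ((if c \<le> x then A * \<omega> * cos (\<omega> * (x - c)) else 0)
         + (if d \<le> x then B * \<omega> * cos (\<omega> * (x - d)) else 0)))
      = \<omega>\<^sup>2 * (LINT x|lebesgue_on {a<..<b}. U x * (A * sine_from \<omega> c x + B * sine_from \<omega> d x))
        - \<omega> * (A * U c + B * U d)"
proof -
  let ?M = "lebesgue_on {a<..<b}"
  have "(LINT x|?M. U x * (A * sine_from \<omega> c x + B * sine_from \<omega> d x))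
      = (LINT x|?M. A * (U x * sine_from \<omega> c x) + B * (U x * sine_from \<omega> d x))"
    by (rule Bochner_Integration.integral_cong) (auto simp: algebra_simps)
  then have comb: "(LINT x|?M. U x * (A * sine_from \<omega> c x + B * sine_from \<omega> d x))
      = A * (LINT x|?M. U x * sine_from \<omega> c x) + B * (LINT x|?M. U x * sine_from \<omega> d x)"
    using sine_from_integrable[OF assms(5)] by simp
  have *: "(LINT x|?M. (if c \<le> x then u' x * (A * \<omega> * cos (\<omega> * (x - c))) else 0))
      = \<omega>\<^sup>2 * A * (LINT x|?M. U x * sine_from \<omega> c x) - \<omega> * A * U c" if "c \<in> {a..b}" for A c
  proof -
    have "(LINT x|?M. (if c \<le> x then U x * - (A * \<omega> * \<omega> * sin (\<omega> * (x - c))) else 0))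
        = (LINT x|?M. - (\<omega>\<^sup>2 * A) * (U x * sine_from \<omega> c x))"
      by (rule Bochner_Integration.integral_cong) (auto simp: sine_from_def power2_eq_square)
    then show ?thesis
      using parts[OF that smooth_cosine[of "A * \<omega>" \<omega> c]] unfolding deriv_cosine by simp
  qed
  have int: "integrable ?M (\<lambda>x. if c \<le> x then u' x * (A * \<omega> * cos (\<omega> * (x - c))) else 0)" for A c
    by (rule integrable_restrict_ge[OF L2_on_mult_integrable[OF assms(4) L2_on_smooth[OF smooth_cosine]]])
  have "(LINT x|?M. u' x * ((if c \<le> x then A * \<omega> * cos (\<omega> * (x - c)) else 0)
         + (if d \<le> x then B * \<omega> * cos (\<omega> * (x - d)) else 0)))
      = (LINT x|?M. (if c \<le> x then u' x * (A * \<omega> * cos (\<omega> * (x - c))) else 0)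
         + (if d \<le> x then u' x * (B * \<omega> * cos (\<omega> * (x - d))) else 0))"
    by (rule Bochner_Integration.integral_cong) (auto simp: distrib_left)
  also have "\<dots> = (\<omega>\<^sup>2 * A * (LINT x|?M. U x * sine_from \<omega> c x) - \<omega> * A * U c)
      + (\<omega>\<^sup>2 * B * (LINT x|?M. U x * sine_from \<omega> d x) - \<omega> * B * U d)"
    by (simp only: Bochner_Integration.integral_add[OF int int] *[OF assms(2)] *[OF assms(3)])
  finally show ?thesis unfolding comb by (simp add: algebra_simps)
qed

text \<open>The condition on \<open>A\<close> and \<open>B\<close> says that the glued arcs vanish
  at \<open>b\<close>, which makes them admissible. The frequency stays free and is not tied to
  \<open>f\<close>, so one lemma serves both the eigenvalue problem and the nonlinear
  equation.\<close>

lemma dirichlet_weak_solution_test_sine_from: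
  assumes "a < b" "dirichlet_weak_solution {a<..<b} f u"
  obtains U where "continuous_on {a..b} U" "U a = 0" "U b = 0" "AE x in lebesgue_on {a<..<b}. u x = U x"
    "\<And>c d A B \<omega>. c \<in> {a..<b} \<Longrightarrow> d \<in> {a..<b} \<Longrightarrow> A * sin (\<omega> * (b - c)) + B * sin (\<omega> * (b - d)) = 0 \<Longrightarrow>
      integrable (lebesgue_on {a<..<b}) (\<lambda>x. f x * (A * sine_from \<omega> c x + B * sine_from \<omega> d x)) \<and>
      (LINT x|lebesgue_on {a<..<b}. f x * (A * sine_from \<omega> c x + B * sine_from \<omega> d x))
      = \<omega>\<^sup>2 * (LINT x|lebesgue_on {a<..<b}. U x * (A * sine_from \<omega> c x + B * sine_from \<omega> d x))
        - \<omega> * (A * U c + B * U d)"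
proof -
  obtain u' where u': "H10_deriv {a<..<b} u u'"
    and weak: "\<And>v v'. H10_deriv {a<..<b} v v' \<Longrightarrow> integrable (lebesgue_on {a<..<b}) (\<lambda>x. f x * v x) \<and>
      (LINT x|lebesgue_on {a<..<b}. u' x * v' x) = (LINT x|lebesgue_on {a<..<b}. f x * v x)"
    using assms(2) unfolding dirichlet_weak_solution_def by blast
  have L2: "L2_on {a<..<b} u'" using u' by (auto simp: H10_deriv_def H1_deriv_def)
  obtain U where U: "continuous_on {a..b} U" "U a = 0" "U b = 0" "AE x in lebesgue_on {a<..<b}. u x = U x"
    and parts: "\<And>c g. c \<in> {a..b} \<Longrightarrow> smooth g \<Longrightarrow>
      (LINT x|lebesgue_on {a<..<b}. (if c \<le> x then u' x * g x else 0))
      = - U c * g c - (LINT x|lebesgue_on {a<..<b}. (if c \<le> x then U x * deriv g x else 0))"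
    using H10_deriv_representative[OF assms(1) u'] by blast
  show ?thesis
  proof (rule that[OF U])
    fix c d A B \<omega> :: real
    assume c: "c \<in> {a..<b}" and d: "d \<in> {a..<b}" and 0: "A * sin (\<omega> * (b - c)) + B * sin (\<omega> * (b - d)) = 0"
    have cd: "c \<in> {a..b}" "d \<in> {a..b}" using c d by auto
    show "integrable (lebesgue_on {a<..<b}) (\<lambda>x. f x * (A * sine_from \<omega> c x + B * sine_from \<omega> d x)) \<and>
      (LINT x|lebesgue_on {a<..<b}. f x * (A * sine_from \<omega> c x + B * sine_from \<omega> d x))
      = \<omega>\<^sup>2 * (LINT x|lebesgue_on {a<..<b}. U x * (A * sine_from \<omega> c x + B * sine_from \<omega> d x))
        - \<omega> * (A * U c + B * U d)"
      using weak[OF H10_deriv_sine_from[OF assms(1) c d 0]]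
        H10_inner_sine_from[OF assms(1) cd L2 U(1) parts, of A \<omega> B] by simp
  qed
qed

section \<open>The Dirichlet eigenpairs of an interval\<close>

lemma dirichlet_eigenfunction_sine:
  assumes "a < b" "j \<ge> 1" "\<omega> = real j * pi / (b - a)"
  shows "dirichlet_eigenfunction {a<..<b} (\<omega>\<^sup>2) (sine_from \<omega> a)"
proof -
  have \<omega>: "\<omega> > 0" "\<omega> * (b - a) = real j * pi" using assms by auto
  \<comment> \<open>A single arc is the two-arc combination whose second coefficient is 0.\<close>
  have 0: "1 * sin (\<omega> * (b - a)) + 0 * sin (\<omega> * (b - a)) = 0" by (simp add: \<omega>)
  have a: "a \<in> {a..<b}" "a \<in> {a..b}" using assms(1) by auto
  have s: "1 * sine_from \<omega> a x + 0 * sine_from \<omega> a x = sine_from \<omega> a x" for x by simp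
  define e' where "e' x = (if a \<le> x then 1 * \<omega> * cos (\<omega> * (x - a)) else 0)
         + (if a \<le> x then 0 * \<omega> * cos (\<omega> * (x - a)) else 0)" for x
  have H: "H10_deriv {a<..<b} (sine_from \<omega> a) e'"
    using H10_deriv_sine_from[OF assms(1) a(1) a(1) 0] unfolding e'_def[abs_def] s .
  have "\<not> (AE x in lebesgue_on {a<..<b}. sine_from \<omega> a x = 0)"
  proof
    assume "AE x in lebesgue_on {a<..<b}. sine_from \<omega> a x = 0"
    \<comment> \<open>Within \<open>pi / \<omega>\<close> of \<open>a\<close> the sine is strictly
      positive, so no point of this interval can be a zero.\<close>
    then have "\<exists>x\<in>{a<..<min b (a + pi / \<omega>)}. sine_from \<omega> a x = 0"
      by (rule AE_Ioo_ex) (use assms(1) \<omega> in auto)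
    then obtain x where x: "x \<in> {a<..<min b (a + pi / \<omega>)}" "sine_from \<omega> a x = 0" by blast
    then have "0 < \<omega> * (x - a)" "\<omega> * (x - a) < pi" using \<omega> by (auto simp: field_simps)
    then have "sin (\<omega> * (x - a)) > 0" by (rule sin_gt_zero)
    then show False using x by (simp add: sine_from_def)
  qed
  moreover have "integrable (lebesgue_on {a<..<b}) (\<lambda>x. \<omega>\<^sup>2 * sine_from \<omega> a x * v x) \<and>
      (LINT x|lebesgue_on {a<..<b}. e' x * v' x) = (LINT x|lebesgue_on {a<..<b}. \<omega>\<^sup>2 * sine_from \<omega> a x * v x)"
    if v: "H10_deriv {a<..<b} v v'" for v v'
  proof
    let ?M = "lebesgue_on {a<..<b}"
    have L2: "L2_on {a<..<b} v" "L2_on {a<..<b} v'" "L2_on {a<..<b} (sine_from \<omega> a)"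
      using v H by (auto simp: H10_deriv_def H1_deriv_def)
    have "integrable ?M (\<lambda>x. \<omega>\<^sup>2 * (sine_from \<omega> a x * v x))"
      by (intro integrable_mult_right L2_on_mult_integrable L2)
    then show "integrable ?M (\<lambda>x. \<omega>\<^sup>2 * sine_from \<omega> a x * v x)" by (simp add: mult.assoc)
    obtain V where V: "continuous_on {a..b} V" "V a = 0" "V b = 0" "AE x in ?M. v x = V x"
      and parts: "\<And>c g. c \<in> {a..b} \<Longrightarrow> smooth g \<Longrightarrow>
        (LINT x|?M. (if c \<le> x then v' x * g x else 0))
        = - V c * g c - (LINT x|?M. (if c \<le> x then V x * deriv g x else 0))"
      using H10_deriv_representative[OF assms(1) v] by blast
    have meas: "V \<in> borel_measurable ?M" "v \<in> borel_measurable ?M" "sine_from \<omega> a \<in> borel_measurable ?M"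
      using L2 continuous_on_Icc_imp_measurable_Ioo[OF V(1)] by (auto simp: L2_on_def)
    \<comment> \<open>The roles are swapped: the test function is the one represented by
      \<open>V\<close>, and the kink of the sine sits at \<open>a\<close>, where \<open>V\<close>
      vanishes.\<close>
    have "(LINT x|?M. v' x * e' x) = \<omega>\<^sup>2 * (LINT x|?M. V x * sine_from \<omega> a x)"
      using H10_inner_sine_from[OF assms(1) a(2) a(2) L2(2) V(1) parts, of 1 \<omega> 0] V(2)
      unfolding e'_def s by simp
    also have "(LINT x|?M. V x * sine_from \<omega> a x) = (LINT x|?M. sine_from \<omega> a x * v x)"
      using V(4) meas by (intro integral_cong_AE) (auto intro: borel_measurable_times)
    finally show "(LINT x|?M. e' x * v' x) = (LINT x|?M. \<omega>\<^sup>2 * sine_from \<omega> a x * v x)"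
      by (simp only: mult.assoc integral_mult_right_zero mult.commute[of "v' _"])
  qed
  ultimately show ?thesis
    using H unfolding dirichlet_eigenfunction_def dirichlet_weak_solution_def by blast
qed

text \<open>Testing with \<open>e\<close> itself makes the integral of \<open>(e' x)\<^sup>2\<close>
  equal to \<open>\<mu>\<close> times that of \<open>(e x)\<^sup>2\<close>. For \<open>\<mu>\<close>
  not positive this forces \<open>e'\<close> to vanish almost everywhere, and integration by parts
  with the constant 1 recovers \<open>U = 0\<close>. Positivity is what allows \<open>\<mu>\<close>
  to be written as the square of a positive frequency.\<close>

lemma dirichlet_eigenvalue_pos:
  assumes "a < b" "dirichlet_eigenfunction {a<..<b} \<mu> e"
  shows "\<mu> > 0"
proof (rule ccontr)
  assume \<mu>: "\<not> \<mu> > 0"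
  let ?M = "lebesgue_on {a<..<b}"
  obtain e' where H: "H10_deriv {a<..<b} e e'"
    and weak: "\<And>v v'. H10_deriv {a<..<b} v v' \<Longrightarrow>
      (LINT x|?M. e' x * v' x) = (LINT x|?M. \<mu> * e x * v x)"
    using assms(2) unfolding dirichlet_eigenfunction_def dirichlet_weak_solution_def by blast
  obtain U where "continuous_on {a..b} U" "U a = 0" "U b = 0" and U: "AE x in ?M. e x = U x"
    and parts: "\<And>c g. c \<in> {a..b} \<Longrightarrow> smooth g \<Longrightarrow>
        (LINT x|?M. (if c \<le> x then e' x * g x else 0))
        = - U c * g c - (LINT x|?M. (if c \<le> x then U x * deriv g x else 0))"
    using H10_deriv_representative[OF assms(1) H] by blast
  have "(LINT x|?M. (e' x)\<^sup>2) = (LINT x|?M. \<mu> * (e x)\<^sup>2)"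
    using weak[OF H] by (simp add: power2_eq_square mult.assoc)
  also have "\<dots> = \<mu> * (LINT x|?M. (e x)\<^sup>2)" by simp
  also have "\<dots> \<le> 0" using \<mu> by (intro mult_nonpos_nonneg integral_nonneg_AE) auto
  finally have "(LINT x|?M. (e' x)\<^sup>2) \<le> 0" .
  moreover have "(LINT x|?M. (e' x)\<^sup>2) \<ge> 0" by (intro integral_nonneg_AE) auto
  ultimately have "(LINT x|?M. (e' x)\<^sup>2) = 0" by linarith
  moreover have int: "integrable ?M (\<lambda>x. (e' x)\<^sup>2)"
    using H by (auto simp: H10_deriv_def H1_deriv_def L2_on_def)
  ultimately have e': "AE x in ?M. e' x = 0"
    using integral_nonneg_eq_0_iff_AE[OF int] by simp
  have U0: "U c = 0" if "c \<in> {a..b}" for c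
  proof -
    have "(LINT x|?M. (if c \<le> x then e' x * 1 else 0)) = 0"
      by (rule integral_eq_zero_AE) (use e' in eventually_elim, simp)
    moreover have "deriv (\<lambda>x. 1) = (\<lambda>x::real. 0 :: real)" by (rule ext) simp
    ultimately show ?thesis using parts[OF that smooth_const[of 1]] by (simp cong: if_cong)
  qed
  have "AE x in ?M. e x = 0" using U AE_space by eventually_elim (use U0 in auto)
  then show False using assms(2) by (simp add: dirichlet_eigenfunction_def)
qed

lemma dirichlet_eigenfunction_imp_sine:
  assumes "a < b" "dirichlet_eigenfunction {a<..<b} \<mu> e"
  obtains j :: nat and C where "j \<ge> 1" "\<mu> = (real j * pi / (b - a))\<^sup>2" "C \<noteq> 0"
    "AE x in lebesgue_on {a<..<b}. e x = C * sin (real j * pi / (b - a) * (b - x))"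
proof -
  let ?M = "lebesgue_on {a<..<b}"
  define \<omega> where "\<omega> = sqrt \<mu>"
  have \<mu>: "\<mu> = \<omega>\<^sup>2" "\<omega> > 0" using dirichlet_eigenvalue_pos[OF assms] by (auto simp: \<omega>_def)
  have sol: "dirichlet_weak_solution {a<..<b} (\<lambda>x. \<mu> * e x) e"
    using assms(2) by (simp add: dirichlet_eigenfunction_def)
  obtain U where contU: "continuous_on {a..b} U" and Ua: "U a = 0" and "U b = 0" and eU: "AE x in ?M. e x = U x"
    and weak: "\<And>c d A B \<omega>. c \<in> {a..<b} \<Longrightarrow> d \<in> {a..<b} \<Longrightarrow> A * sin (\<omega> * (b - c)) + B * sin (\<omega> * (b - d)) = 0 \<Longrightarrow>
      integrable ?M (\<lambda>x. \<mu> * e x * (A * sine_from \<omega> c x + B * sine_from \<omega> d x)) \<and>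
      (LINT x|?M. \<mu> * e x * (A * sine_from \<omega> c x + B * sine_from \<omega> d x))
      = \<omega>\<^sup>2 * (LINT x|?M. U x * (A * sine_from \<omega> c x + B * sine_from \<omega> d x)) - \<omega> * (A * U c + B * U d)"
    using dirichlet_weak_solution_test_sine_from[OF assms(1) sol] by blast
  have comb: "A * U c + B * U d = 0"
    if cd: "c \<in> {a..<b}" "d \<in> {a..<b}" and 0: "A * sin (\<omega> * (b - c)) + B * sin (\<omega> * (b - d)) = 0" for A B c d
  proof -
    let ?v = "\<lambda>x. A * sine_from \<omega> c x + B * sine_from \<omega> d x"
    have mv: "?v \<in> borel_measurable ?M"
      using H10_deriv_sine_from[OF assms(1) cd 0] by (auto simp: H10_deriv_def H1_deriv_def L2_on_def)
    have mU: "U \<in> borel_measurable ?M"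
      by (rule continuous_on_Icc_imp_measurable_Ioo[OF contU])
    have me: "e \<in> borel_measurable ?M"
      using assms(2) by (auto simp: dirichlet_eigenfunction_def dirichlet_weak_solution_def
          H10_deriv_def H1_deriv_def L2_on_def)
    have "(LINT x|?M. \<mu> * e x * ?v x) = (LINT x|?M. \<mu> * (U x * ?v x))"
    proof (rule integral_cong_AE)
      show "AE x in ?M. \<mu> * e x * ?v x = \<mu> * (U x * ?v x)" using eU by eventually_elim simp
    qed (intro borel_measurable_times mv mU me borel_measurable_const)+
    also have "\<dots> = \<omega>\<^sup>2 * (LINT x|?M. U x * ?v x)" by (simp add: \<mu>)
    finally show ?thesis using weak[OF cd 0] \<mu>(2) by simp
  qed
  obtain z where z: "z \<in> {a<..<b}" "U z \<noteq> 0"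
  proof (rule ccontr)
    assume "\<not> thesis"
    then have U0: "\<And>z. z \<in> {a<..<b} \<Longrightarrow> U z = 0" using that by blast
    have "AE x in ?M. e x = 0" using eU AE_space by eventually_elim (use U0 in auto)
    then show False using assms(2) by (simp add: dirichlet_eigenfunction_def)
  qed
  \<comment> \<open>Coefficients chosen as the two-point null vector of the sine values. As
    \<open>U a = 0\<close> and \<open>U z\<close> is nonzero, the frequency is quantized.\<close>
  have "sin (\<omega> * (b - z)) * U a + - sin (\<omega> * (b - a)) * U z = 0"
    by (rule comb) (use z assms(1) in auto)
  then have "sin (\<omega> * (b - a)) = 0" using Ua z by simp
  then obtain i :: int where i: "\<omega> * (b - a) = of_int i * pi" using sin_zero_iff_int2 by blast
  have "of_int i * pi > 0" using \<mu>(2) assms(1) i by (metis diff_gt_0_iff_gt mult_pos_pos)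
  then have "i > 0" by (simp add: zero_less_mult_iff)
  then obtain j where j: "i = int j" "j \<ge> 1" using zero_less_imp_eq_int[of i] by auto
  have \<omega>j: "\<omega> * (b - a) = real j * pi" using i j by simp
  have \<omega>: "\<omega> = real j * pi / (b - a)" using \<omega>j assms(1) by (simp add: field_simps)
  \<comment> \<open>Reference point where \<open>sin (\<omega> * (b - d)) = 1\<close>, so that the
    relation between \<open>U d\<close> and \<open>U x\<close> gives \<open>U x\<close> without
    division. It lies in the interval because \<open>\<omega> * (b - a)\<close> is at least
    \<open>pi\<close>.\<close>
  define d where "d = b - pi / 2 / \<omega>"
  have d: "d \<in> {a..<b}" "\<omega> * (b - d) = pi / 2"
  proof -
    have "pi / 2 \<le> 1 * pi" by simp
    also have "\<dots> \<le> \<omega> * (b - a)" unfolding \<omega>j using j by (intro mult_right_mono) auto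
    finally have "pi / 2 / \<omega> \<le> b - a" using \<mu>(2) by (simp add: field_simps)
    then show "d \<in> {a..<b}" using \<mu>(2) by (simp add: d_def)
    show "\<omega> * (b - d) = pi / 2" using \<mu>(2) by (simp add: d_def)
  qed
  have U: "U x = U d * sin (\<omega> * (b - x))" if "x \<in> {a<..<b}" for x
  proof -
    have "sin (\<omega> * (b - x)) * U d + - 1 * U x = 0"
      by (rule comb) (use that d in \<open>auto simp: d(2)\<close>)
    then show ?thesis by (simp add: mult.commute)
  qed
  have "U d \<noteq> 0" using U[OF z(1)] z(2) by auto
  moreover have "AE x in ?M. e x = U d * sin (\<omega> * (b - x))"
    using eU AE_space by eventually_elim (use U in auto)
  ultimately show ?thesis using that[OF j(2), of "U d"] \<mu>(1) unfolding \<omega> by blast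
qed

lemma dirichlet_eigenvalues_Ioo:
  assumes "a < b"
  shows "dirichlet_eigenvalues {a<..<b} = (\<lambda>j. (real j * pi / (b - a))\<^sup>2) ` {1..}"
proof (intro equalityI subsetI)
  fix \<mu> assume "\<mu> \<in> dirichlet_eigenvalues {a<..<b}"
  then obtain e where "dirichlet_eigenfunction {a<..<b} \<mu> e" by (auto simp: dirichlet_eigenvalues_def)
  from dirichlet_eigenfunction_imp_sine[OF assms this] obtain j :: nat
    where "j \<ge> 1" "\<mu> = (real j * pi / (b - a))\<^sup>2" by metis
  then show "\<mu> \<in> (\<lambda>j. (real j * pi / (b - a))\<^sup>2) ` {1..}" by auto
next
  fix \<mu> assume "\<mu> \<in> (\<lambda>j. (real j * pi / (b - a))\<^sup>2) ` {1..}"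
  then obtain j :: nat where "j \<ge> 1" "\<mu> = (real j * pi / (b - a))\<^sup>2" by auto
  then show "\<mu> \<in> dirichlet_eigenvalues {a<..<b}"
    using dirichlet_eigenfunction_sine[OF assms, of j] by (auto simp: dirichlet_eigenvalues_def)
qed

text \<open>The index of a value is recovered from the image alone, as \<open>m\<close> plus the
  number of smaller elements. This identifies the arbitrary increasing enumeration
  \<open>lam\<close> with the explicit one.\<close>

lemma strict_mono_on_enumeration_unique:
  fixes f g :: "nat \<Rightarrow> 'a :: linorder"
  assumes f: "strict_mono_on {m..} f" and g: "strict_mono_on {m..} g" and "f ` {m..} = g ` {m..}" and "n \<ge> m"
  shows "f n = g n"
proof -
  have card: "card {y \<in> h ` {m..}. y < h i} = i - m" if h: "strict_mono_on {m..} h" and "i \<ge> m" for h :: "nat \<Rightarrow> 'a" and i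
  proof -
    have "{y \<in> h ` {m..}. y < h i} = h ` {m..<i}"
      using strict_mono_on_less[OF h] that(2) by auto
    moreover have "inj_on h {m..<i}"
      by (rule inj_on_subset[OF strict_mono_on_imp_inj_on[OF h]]) auto
    ultimately show ?thesis by (simp add: card_image)
  qed
  have "f n \<in> g ` {m..}" unfolding assms(3)[symmetric] using assms(4) by simp
  then obtain i where i: "i \<ge> m" "f n = g i" by auto
  have "n - m = i - m"
    using card[OF f \<open>n \<ge> m\<close>] card[OF g i(1)] assms(3) i(2) by simp
  then have "n = i" using i(1) assms(4) by linarith
  then show ?thesis using i(2) by simp
qed

section \<open>Sign changes and zeros of solutions\<close>

text \<open>The sign \<open>s\<close> treats nodal intervals with \<open>w\<close> positive and
  negative at once: the nonlinearity is odd, so multiplying the equation by \<open>s\<close> reduces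
  one case to the other. The weak equation is only assumed for the frequency matching the interval
  length.\<close>

lemma dirichlet_solution_sign_on_nodal_interval:
  assumes ab: "a < b" and \<omega>: "\<omega> > 0" and c: "c \<in> {a..<b}" "c + pi / \<omega> \<le> b"
    and U: "continuous_on {a..b} U" "U b = 0" "AE x in lebesgue_on {a<..<b}. u x = U x"
    and weak: "\<And>c d A B. c \<in> {a..<b} \<Longrightarrow> d \<in> {a..<b} \<Longrightarrow> A * sin (\<omega> * (b - c)) + B * sin (\<omega> * (b - d)) = 0 \<Longrightarrow>
      integrable (lebesgue_on {a<..<b}) (\<lambda>x. (\<bar>u x\<bar> powr (p - 1) * u x + w x) * (A * sine_from \<omega> c x + B * sine_from \<omega> d x)) \<and>
      (LINT x|lebesgue_on {a<..<b}. (\<bar>u x\<bar> powr (p - 1) * u x + w x) * (A * sine_from \<omega> c x + B * sine_from \<omega> d x))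
      = \<omega>\<^sup>2 * (LINT x|lebesgue_on {a<..<b}. U x * (A * sine_from \<omega> c x + B * sine_from \<omega> d x))
        - \<omega> * (A * U c + B * U d)"
    and s: "s = 1 \<or> s = (-1 :: real)"
    and w: "AE x in lebesgue_on {a<..<b}. x \<in> {c<..<c + pi / \<omega>} \<longrightarrow> s * w x > r"
    and r: "\<And>t. t \<ge> 0 \<Longrightarrow> \<omega>\<^sup>2 * t - t powr p \<le> r"
  shows "\<exists>x\<in>{c<..<c + pi / \<omega>}. s * U x < 0"
proof (rule ccontr)
  assume "\<not> ?thesis"
  then have pos: "s * U x \<ge> 0" if "x \<in> {c<..<c + pi / \<omega>}" for x
    using that not_less by blast
  let ?M = "lebesgue_on {a<..<b}"
  define d where "d = c + pi / \<omega>"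
  have cd: "c < d" "d \<le> b" "a \<le> c" using c \<omega> by (auto simp: d_def)
  \<comment> \<open>The boundary terms involve the closed end points, which the negated claim does
    not cover; continuity extends the sign to them.\<close>
  have pos_cl: "s * U x \<ge> 0" if "x \<in> {c..d}" for x
  proof -
    have "continuous_on (closure {c<..<d}) (\<lambda>x. s * U x)"
      using cd by (intro continuous_on_mult_left continuous_on_subset[OF U(1)]) auto
    then show ?thesis
      by (rule continuous_ge_on_closure) (use that cd pos in \<open>auto simp: d_def\<close>)
  qed
  \<comment> \<open>If \<open>d = b\<close>, the first arc already vanishes at \<open>b\<close>: the
    second gets coefficient 0, and \<open>d'\<close> is a dummy kink that stays in the admissible
    range. Since \<open>U b = 0\<close>, the boundary term \<open>B * U d'\<close> equals
    \<open>U d\<close> in both cases.\<close>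
  define B where "B = (if d < b then 1 else 0 :: real)"
  define d' where "d' = (if d < b then d else c)"
  define v where "v x = 1 * sine_from \<omega> c x + B * sine_from \<omega> d' x" for x
  have shift: "\<omega> * (x - c) = \<omega> * (x - d) + pi" for x
    using \<omega> by (simp add: d_def field_simps)
  have d': "d' \<in> {a..<b}" "1 * sin (\<omega> * (b - c)) + B * sin (\<omega> * (b - d')) = 0" "B * U d' = U d"
    using c cd shift[of b] U(2) by (auto simp: d'_def B_def)
  have v: "v x = (if x \<in> {c..<d} then sin (\<omega> * (x - c)) else 0)" if "x \<in> {a<..<b}" for x
    using that cd shift[of x] by (auto simp: v_def sine_from_def B_def d'_def)
  have v_pos: "v x > 0" if "x \<in> {c<..<d}" for x
  proof -
    have "sin (\<omega> * (x - c)) > 0"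
      using that \<omega> by (intro sin_gt_zero) (auto simp: d_def field_simps)
    then show ?thesis using that cd by (subst v) auto
  qed
  define f where "f x = \<bar>u x\<bar> powr (p - 1) * u x + w x" for x
  have int: "integrable ?M (\<lambda>x. f x * v x)" "integrable ?M (\<lambda>x. U x * v x)"
    and eq: "(LINT x|?M. f x * v x) = \<omega>\<^sup>2 * (LINT x|?M. U x * v x) - \<omega> * (U c + U d)"
  proof -
    show "integrable ?M (\<lambda>x. f x * v x)"
      "(LINT x|?M. f x * v x) = \<omega>\<^sup>2 * (LINT x|?M. U x * v x) - \<omega> * (U c + U d)"
      using weak[OF c(1) d'(1,2)] d'(3) unfolding v_def f_def by auto
    have "integrable ?M (\<lambda>x. U x * sine_from \<omega> c x + B * (U x * sine_from \<omega> d' x))"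
      using sine_from_integrable[OF U(1)] by simp
    then show "integrable ?M (\<lambda>x. U x * v x)" by (simp add: v_def algebra_simps)
  qed
  \<comment> \<open>The contradiction lies in this integrand: the lower bound on
    \<open>s * w x\<close> makes it nonnegative almost everywhere and positive between
    \<open>c\<close> and \<open>d\<close>, whereas its integral is
    \<open>- (\<omega> * (s * U c + s * U d))\<close>, which is at most 0.\<close>
  define F where "F x = s * (f x * v x) - s * \<omega>\<^sup>2 * (U x * v x)" for x
  have intF: "integrable ?M F"
    unfolding F_def[abs_def] using int by (intro Bochner_Integration.integrable_diff integrable_mult_right)
  have F: "AE x in ?M. F x \<ge> 0 \<and> (x \<in> {c<..<d} \<longrightarrow> F x > 0)"
    using w U(3) AE_neq_Ioo[where c=c] AE_space
  proof eventually_elim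
    case (elim x)
    show ?case
    proof (cases "x \<in> {c<..<d}")
      case True
      have sU: "s * U x = \<bar>U x\<bar>" using pos[of x] True s by (auto simp: d_def)
      have "s * (\<bar>U x\<bar> powr (p - 1) * U x) = \<bar>U x\<bar> powr (p - 1) * \<bar>U x\<bar>"
        by (metis sU mult.left_commute)
      \<comment> \<open>The zero case is split off because \<open>0 powr y\<close> is 0 for every
        \<open>y\<close>.\<close>
      also have "\<dots> = \<bar>U x\<bar> powr p"
        using powr_mult_base[of "\<bar>U x\<bar>" "p - 1"] by (cases "U x = 0") (auto simp: mult.commute)
      finally have "s * f x = \<bar>U x\<bar> powr p + s * w x" using elim(2) by (simp add: f_def distrib_left)
      moreover have "s * w x > r" using elim(1) True by (simp add: d_def)
      ultimately have "s * f x - \<omega>\<^sup>2 * (s * U x) > 0" using r[of "\<bar>U x\<bar>"] sU by simp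
      then have "(s * f x - \<omega>\<^sup>2 * (s * U x)) * v x > 0" using v_pos[OF True] by simp
      then have "F x > 0" by (simp add: F_def algebra_simps)
      then show ?thesis by simp
    next
      case False
      then show ?thesis using elim v[of x] by (auto simp: F_def)
    qed
  qed
  have "(LINT x|?M. F x) = s * (LINT x|?M. f x * v x) - s * \<omega>\<^sup>2 * (LINT x|?M. U x * v x)"
    unfolding F_def using int by simp
  also have "\<dots> = - (\<omega> * (s * U c + s * U d))" unfolding eq by (simp add: algebra_simps)
  also have "\<dots> \<le> 0" using pos_cl[of c] pos_cl[of d] cd \<omega> by simp
  finally have "(LINT x|?M. F x) \<le> 0" .
  moreover have nn: "AE x in ?M. 0 \<le> F x" using F by eventually_elim simp
  moreover have "(LINT x|?M. F x) \<ge> 0" using nn by (rule integral_nonneg_AE)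
  ultimately have "AE x in ?M. F x = 0" using integral_nonneg_eq_0_iff_AE[OF intF nn] by simp
  then have "AE x in ?M. x \<notin> {c<..<d}" using F by eventually_elim auto
  then have "\<exists>x\<in>{c<..<d}. x \<notin> {c<..<d}" by (rule AE_Ioo_ex) (use cd in auto)
  then show False by blast
qed

lemma essinf_AE_gt:
  assumes "essinf M f > ereal r"
  shows "AE x in M. f x > r"
proof -
  have "AE x in M. - ereal (f x) \<le> esssup M (\<lambda>x. - ereal (f x))" by (rule esssup_AE)
  then show ?thesis
  proof eventually_elim
    case (elim x)
    have "ereal r < - esssup M (\<lambda>x. - ereal (f x))" using assms by (simp add: essinf_def)
    also have "\<dots> \<le> ereal (f x)" using elim by (simp add: ereal_uminus_le_reorder)
    finally show ?case by simp
  qed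
qed

text \<open>A real \<open>SUP\<close> bounds its set only if the set is bounded above, so this is
  what makes the threshold in the hypothesis on \<open>w\<close> usable. For large \<open>t\<close>
  the superlinear power dominates.\<close>

lemma bdd_above_linear_minus_powr:
  fixes l p :: real
  assumes "p > 1"
  shows "bdd_above ((\<lambda>t. l * t - t powr p) ` {0..})"
proof (rule bdd_aboveI2)
  fix t :: real assume t: "t \<in> {0..}"
  \<comment> \<open>The point where \<open>K powr (p - 1) = \<bar>l\<bar>\<close>; beyond it the
    difference is at most 0.\<close>
  define K where "K = \<bar>l\<bar> powr (1 / (p - 1))"
  show "l * t - t powr p \<le> \<bar>l\<bar> * K"
  proof (cases "t \<le> K")
    case True
    have "l * t \<le> \<bar>l\<bar> * K" using True t by (intro mult_mono) auto
    then show ?thesis using powr_ge_zero[of t p] by linarith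
  next
    case False
    have K: "K \<ge> 0" by (simp add: K_def)
    have "\<bar>l\<bar> = K powr (p - 1)" using assms by (simp add: K_def powr_powr)
    also have "\<dots> \<le> t powr (p - 1)" using False K assms by (intro powr_mono2) auto
    finally have "\<bar>l\<bar> * t \<le> t powr (p - 1) * t" using t by (intro mult_right_mono) auto
    also have "\<dots> = t powr p" using powr_mult_base[of t "p - 1"] t by (simp add: mult.commute)
    finally have "\<bar>l\<bar> * t \<le> t powr p" .
    moreover have "l * t \<le> \<bar>l\<bar> * t" using t by (intro mult_right_mono) auto
    moreover have "\<bar>l\<bar> * K \<ge> 0" using K by simp
    ultimately show ?thesis by linarith
  qed
qed

theorem corollary3p6:
  fixes a b p :: real and lam :: "nat \<Rightarrow> real" and e w u :: "real \<Rightarrow> real" and k h :: nat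
  assumes "a < b" and "p > 1"
    and "strict_mono_on {1..} lam"
    and "lam ` {1..} = dirichlet_eigenvalues {a<..<b}"
    and "k \<ge> 1"
    and "dirichlet_eigenfunction {a<..<b} (lam k) e"
    and "L2_on {a<..<b} w"
    and "AE x in lebesgue_on {a<..<b}. e x * w x \<ge> 0"
    and "essinf (lebesgue_on {a<..<b}) (\<lambda>x. \<bar>w x\<bar>) > ereal (SUP t\<in>{0..}. lam k * t - t powr p)"
    and "h = k - 1"
    and "dirichlet_weak_solution {a<..<b} (\<lambda>x. \<bar>u x\<bar> powr (p - 1) * u x + w x) u"
  shows "\<exists>v. continuous_representative {a<..<b} u v \<and>
           (\<exists>\<zeta> :: nat \<Rightarrow> real. inj_on \<zeta> {1..h} \<and>
              (\<forall>i\<in>{1..h}. \<zeta> i \<in> {a<..<b} \<and> v (\<zeta> i) = 0 \<and>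
                 \<bar>a + (b - a) / real k * real i - \<zeta> i\<bar> < (b - a) / real k))"
proof -
  let ?M = "lebesgue_on {a<..<b}"
  define \<omega> where "\<omega> = real k * pi / (b - a)"
  define L where "L = (b - a) / real k"
  have \<omega>: "\<omega> > 0" "pi / \<omega> = L" "\<omega> * (b - a) = real k * pi" "\<omega> * L = pi" "L > 0" "real k * L = b - a"
    using assms(1,5) by (auto simp: \<omega>_def L_def field_simps)
  have mono: "strict_mono_on {1..} (\<lambda>j. (real j * pi / (b - a))\<^sup>2)"
    using assms(1) by (intro strict_mono_onI power_strict_mono divide_strict_right_mono mult_strict_right_mono) auto
  have lam: "lam k = \<omega>\<^sup>2"
    using strict_mono_on_enumeration_unique[OF assms(3) mono _ assms(5)] assms(4)
    unfolding dirichlet_eigenvalues_Ioo[OF assms(1)] \<omega>_def by simp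
  obtain j :: nat and C where j: "lam k = (real j * pi / (b - a))\<^sup>2" and C: "C \<noteq> 0"
    and e: "AE x in ?M. e x = C * sin (real j * pi / (b - a) * (b - x))"
    using dirichlet_eigenfunction_imp_sine[OF assms(1,6)] by metis
  \<comment> \<open>The frequency of \<open>e\<close> comes with its own index \<open>j\<close>; two
    nonnegative numbers with the same square \<open>lam k\<close> agree.\<close>
  have "real j * pi / (b - a) = \<omega>"
    using j lam \<omega>(1) assms(1) by (simp add: power2_eq_iff_nonneg)
  note e = e[unfolded this]
  define r where "r = (SUP t\<in>{0..}. lam k * t - t powr p)"
  have r: "\<omega>\<^sup>2 * t - t powr p \<le> r" if "t \<ge> 0" for t
    unfolding r_def lam using that by (intro cSUP_upper bdd_above_linear_minus_powr assms) auto
  have w: "AE x in ?M. \<bar>w x\<bar> > r" by (rule essinf_AE_gt) (use assms(9) in \<open>simp add: r_def\<close>)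
  obtain U where U: "continuous_on {a..b} U" "U a = 0" "U b = 0" "AE x in ?M. u x = U x"
    and weak: "\<And>c d A B \<omega>. c \<in> {a..<b} \<Longrightarrow> d \<in> {a..<b} \<Longrightarrow> A * sin (\<omega> * (b - c)) + B * sin (\<omega> * (b - d)) = 0 \<Longrightarrow>
      integrable ?M (\<lambda>x. (\<bar>u x\<bar> powr (p - 1) * u x + w x) * (A * sine_from \<omega> c x + B * sine_from \<omega> d x)) \<and>
      (LINT x|?M. (\<bar>u x\<bar> powr (p - 1) * u x + w x) * (A * sine_from \<omega> c x + B * sine_from \<omega> d x))
      = \<omega>\<^sup>2 * (LINT x|?M. U x * (A * sine_from \<omega> c x + B * sine_from \<omega> d x)) - \<omega> * (A * U c + B * U d)"
    using dirichlet_weak_solution_test_sine_from[OF assms(1,11)] by blast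
  \<comment> \<open>The sign of \<open>e\<close> on the \<open>i\<close>-th nodal interval from the
    left. The exponent is \<open>k - i\<close> because the phase of \<open>e\<close> is counted from
    \<open>b\<close>.\<close>
  define s where "s i = sgn C * (-1) ^ (k - i)" for i
  have s: "s i = 1 \<or> s i = -1" for i
    using C by (auto simp: s_def sgn_if minus_one_power_iff)
  have "\<exists>x. x \<in> {a + real i * L - L<..<a + real i * L} \<and> s i * U x < 0" if i: "i \<in> {1..k}" for i
  proof -
    let ?c = "a + real i * L - L"
    have c: "?c + pi / \<omega> = a + real i * L" by (simp add: \<omega>)
    have "real i * L \<ge> 1 * L" "real i * L \<le> real k * L" using i \<omega>(5) by (auto intro!: mult_right_mono)
    then have iL: "a \<le> ?c" "a + real i * L \<le> b" using \<omega>(6) by auto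
    have sw: "s i * w x > r" if x: "x \<in> {?c<..<?c + pi / \<omega>}" and
      ex: "e x = C * sin (\<omega> * (b - x))" and ew: "e x * w x \<ge> 0" and rw: "\<bar>w x\<bar> > r" for x
    proof -
      have "0 < \<omega> * (a + real i * L - x)" "\<omega> * (a + real i * L - x) < \<omega> * L"
        using x c \<omega>(1) by (auto intro!: mult_pos_pos mult_strict_left_mono)
      then have sin: "sin (\<omega> * (a + real i * L - x)) > 0" by (intro sin_gt_zero) (simp_all add: \<omega>)
      \<comment> \<open>The phase is moved from \<open>b\<close> to the right end of the nodal
        interval, where it lies between 0 and \<open>pi\<close>; the \<open>k - i\<close> half
        periods in between produce the sign.\<close>
      have "\<omega> * (b - x) = \<omega> * (a + real i * L - x) + \<omega> * (b - a) - real i * (\<omega> * L)"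
        by (simp add: algebra_simps)
      also have "\<dots> = \<omega> * (a + real i * L - x) + real (k - i) * pi"
        unfolding \<omega>(3,4) using i by (simp add: of_nat_diff left_diff_distrib)
      finally have "sin (\<omega> * (b - x)) = (-1) ^ (k - i) * sin (\<omega> * (a + real i * L - x))"
        by (simp add: sin_add)
      \<comment> \<open>Here \<open>e x * w x\<close> is rearranged as a positive factor times
        \<open>s i * w x\<close>. So \<open>s i * w x\<close> is nonnegative and equals
        \<open>\<bar>w x\<bar>\<close>, which exceeds \<open>r\<close>.\<close>
      then have "0 \<le> \<bar>C\<bar> * sin (\<omega> * (a + real i * L - x)) * (s i * w x)"
        using ew unfolding ex by (simp add: s_def abs_sgn algebra_simps)
      moreover have "0 < \<bar>C\<bar> * sin (\<omega> * (a + real i * L - x))" using sin C by simp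
      ultimately have "s i * w x \<ge> 0" using mult_pos_neg not_le by blast
      moreover have "\<bar>s i * w x\<bar> = \<bar>w x\<bar>" using s[of i] by auto
      ultimately show ?thesis using rw by simp
    qed
    have "AE x in ?M. x \<in> {?c<..<?c + pi / \<omega>} \<longrightarrow> s i * w x > r"
      using e assms(8) w by eventually_elim (use sw in blast)
    then have "\<exists>x\<in>{?c<..<?c + pi / \<omega>}. s i * U x < 0"
      using iL \<omega>(5) c
      by (intro dirichlet_solution_sign_on_nodal_interval[OF assms(1) \<omega>(1) _ _ U(1,3,4) weak s _ r]) auto
    then show ?thesis unfolding c by blast
  qed
  then obtain x where x: "\<And>i. i \<in> {1..k} \<Longrightarrow> x i \<in> {a + real i * L - L<..<a + real i * L}"
    "\<And>i. i \<in> {1..k} \<Longrightarrow> s i * U (x i) < 0"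
    by metis
  have "\<exists>z. x i < z \<and> z < x (Suc i) \<and> z \<in> {a<..<b} \<and> U z = 0" if i: "i \<in> {1..h}" for i
  proof -
    have ik: "i \<in> {1..k}" "Suc i \<in> {1..k}" using i assms(10) by auto
    have "real i * L \<ge> 1 * L" "real (Suc i) * L \<le> real k * L" using ik \<omega>(5) by (auto intro!: mult_right_mono)
    then have x_in: "a < x i" "x i < x (Suc i)" "x (Suc i) < b"
      using x(1)[OF ik(1)] x(1)[OF ik(2)] \<omega>(6)
      unfolding greaterThanLessThan_iff of_nat_Suc distrib_right by linarith+
    \<comment> \<open>Truncated subtraction: this uses that \<open>Suc i\<close> is at most
      \<open>k\<close>, that is, \<open>i\<close> at most \<open>h\<close>. It is the alternation of
      signs between neighbouring nodal intervals.\<close>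
    have "k - i = Suc (k - Suc i)" using ik by auto
    then have "s i = - s (Suc i)" by (simp add: s_def)
    then have "U (x i) * U (x (Suc i)) < 0"
      using x(2)[OF ik(1)] x(2)[OF ik(2)] s[of "Suc i"] by (auto simp: mult_less_0_iff)
    moreover have "continuous_on {x i..x (Suc i)} U"
      using x_in by (intro continuous_on_subset[OF U(1)]) auto
    ultimately obtain z where z: "x i \<le> z" "z \<le> x (Suc i)" "U z = 0"
      using IVT'[of U "x i" 0 "x (Suc i)"] IVT2'[of U "x (Suc i)" 0 "x i"] x_in
      by (auto simp: mult_less_0_iff)
    moreover have "z \<noteq> x i" "z \<noteq> x (Suc i)" using z(3) \<open>U (x i) * U (x (Suc i)) < 0\<close> by auto
    ultimately show ?thesis using x_in by (intro exI[of _ z]) auto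
  qed
  then obtain \<zeta> where \<zeta>: "\<And>i. i \<in> {1..h} \<Longrightarrow> x i < \<zeta> i \<and> \<zeta> i < x (Suc i) \<and> \<zeta> i \<in> {a<..<b} \<and> U (\<zeta> i) = 0"
    by metis
  have ik: "i \<in> {1..k}" "Suc i \<in> {1..k}" if "i \<in> {1..h}" for i using that assms(10) by auto
  \<comment> \<open>Distinctness comes from order: \<open>\<zeta> i\<close> lies to the left of
    \<open>x (Suc i)\<close>, which is at most \<open>x m\<close>, and \<open>\<zeta> m\<close> lies
    to the right of \<open>x m\<close>.\<close>
  have less: "\<zeta> i < \<zeta> m" if im: "i \<in> {1..h}" "m \<in> {1..h}" "i < m" for i m
  proof (cases "m = Suc i")
    case True
    then show ?thesis using \<zeta>[OF im(1)] \<zeta>[OF im(2)] by auto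
  next
    case False
    have "real (Suc i) * L + L \<le> real m * L"
      using False im(3) \<omega>(5) mult_right_mono[of "real (Suc (Suc i))" "real m" L] by (simp add: algebra_simps)
    then have "x (Suc i) < x m" using x(1)[OF ik(2)[OF im(1)]] x(1)[OF ik(1)[OF im(2)]] by auto
    then show ?thesis using \<zeta>[OF im(1)] \<zeta>[OF im(2)] by auto
  qed
  have "inj_on \<zeta> {1..h}"
  proof (rule inj_onI)
    fix i m assume "i \<in> {1..h}" "m \<in> {1..h}" "\<zeta> i = \<zeta> m"
    then show "i = m" using less[of i m] less[of m i] by (cases i m rule: linorder_cases) auto
  qed
  moreover have "\<bar>a + (b - a) / real k * real i - \<zeta> i\<bar> < (b - a) / real k" if i: "i \<in> {1..h}" for i
  proof -
    \<comment> \<open>The sign points enclosing \<open>\<zeta> i\<close> belong to the open nodal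
      intervals of length \<open>L\<close> on either side of \<open>a + real i * L\<close>, so the
      bound is strict.\<close>
    have "\<bar>a + real i * L - \<zeta> i\<bar> < L"
      using \<zeta>[OF i] x(1)[OF ik(1)[OF i]] x(1)[OF ik(2)[OF i]] by (auto simp: abs_less_iff algebra_simps)
    then show ?thesis by (simp add: L_def mult.commute)
  qed
  moreover have "continuous_representative {a<..<b} u U"
    unfolding continuous_representative_def
  proof
    show "continuous_on {a<..<b} U" by (rule continuous_on_subset[OF U(1)]) auto
    show "AE x in ?M. U x = u x" using U(4) by eventually_elim simp
  qed
  ultimately show ?thesis using \<zeta> by blast
qed

end
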